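(* Let $w\in\mathbb C$ satisfy $|w|\le1$, $\operatorname{Re} w>0$, $\operatorname{Im} w\ge0$ and $|1-w^2|\le 2|w|$. Then \begin{align*} \sum_{n=0}^{\infty} \frac{(-1)^n}{(2n+1)^3\binom{2n}{n}}\Bigl(\frac{1-w^2}{w}\Bigr)^{2n+1} &=-2\Bigl[\operatorname{Li}_3\Bigl(\tfrac{1+w}{2}\Bigr)-\operatorname{Li}_3\Bigl(\tfrac{1-w}{2}\Bigr)-\operatorname{Li}_3\Bigl(\tfrac{1+1/w}{2}\Bigr)+\operatorname{Li}_3\Bigl(\tfrac{1-1/w}{2}\Bigr)\Bigr]\\ &\quad+\Bigl[\operatorname{Li}_2\Bigl(\tfrac{1+w}{2}\Bigr)-\operatorname{Li}_2\Bigl(\tfrac{1-w}{2}\Bigr)+\operatorname{Li}_2\Bigl(\tfrac{1+1/w}{2}\Bigr)-\operatorname{Li}_2\Bigl(\tfrac{1-1/w}{2}\Bigr)\Bigr]\log w\\ &\quad+\pi i\,\log\Bigl(\tfrac{1+w}{2}\Bigr)\log\Bigl(\tfrac{1+1/w}{2}\Bigr). \end{align*}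
   Context: $\operatorname{Li}_2$ and $\operatorname{Li}_3$ denote the (principal-branch) analytic continuations of $\operatorname{Li}_s(z)=\sum_{n\ge1}z^n/n^s$ from $|z|\le1$, and $\log$ denotes the principal branch of the logarithm. *)

theory Defs
  imports "HOL-Analysis.Analysis"
begin

text \<open>Principal-branch polylogarithm Li_s for s >= 1 (natural s), via the standard
  recursion Li_1(z) = -Log(1-z), Li_(s+1)(z) = integral over t from 0 to 1 of Li_s(t z)/t,
  with Log the principal logarithm.  On the closed unit disc (for s >= 2) this agrees with
  the series sum_{n>=1} z^n/n^s, and it is the analytic continuation of that series to
  the slit plane C minus [1,oo); on the cut (1,oo) it takes the boundary values from below
  (standard principal-branch convention).  The value at s = 0 is z/(1-z).\<close>

fun polylog :: "nat \<Rightarrow> complex \<Rightarrow> complex" where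
  "polylog 0 z = z / (1 - z)"
| "polylog (Suc 0) z = - Ln (1 - z)"
| "polylog (Suc (Suc k)) z =
     integral {0..1} (\<lambda>t::real. polylog (Suc k) (complex_of_real t * z) / complex_of_real t)"

end

theory Submission
  imports Defs "HOL-Complex_Analysis.Complex_Analysis" "HOL-Real_Asymp.Real_Asymp"
begin

text \<open>Put y = (1/w - w)/2.  Applying y d/dy twice to the series lowers the exponent of 2n+1 from 3 to 1
  and leaves the expansion of 2 arsinh y / sqrt (1 + y^2), which equals - 4 log w / (w + 1/w).  On the
  other side, the w-derivative of the claimed value reduces to dilogarithms and logarithms, and a
  second dilogarithm identity (itself checked by differentiation) brings it into the form predicted by
  the series; one more differentiation leaves only log w.  All constants vanish at w = 1, i.e. y = 0.
  For real w < 1 the argument (1 + 1/w)/2 lies on the branch cut; the derivative formulas for the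
  dilogarithm and trilogarithm are therefore proved within the closed lower half plane, using the
  reflection z \<open>\<mapsto>\<close> 1 - z of the dilogarithm.  The case |y| = 1 follows by uniform convergence.\<close>

subsection \<open>Primitives of polylogarithms on the slit plane\<close>

text \<open>The lower half plane is the right side of the cut for two matching reasons: Im w >= 0
  puts (1 + 1/w)/2 into it, and the convention Im (Ln x) = pi for negative x makes the integrals
  defining \<open>polylog\<close> the limits from below on the cut. A second obstacle is w = 1,
  where (1 + w)/2 and (1 + 1/w)/2 hit the branch point and log ((1 - w)/2) diverges. In every
  combination that occurs this logarithm is multiplied by log w, so continuity survives and w = 1
  can be a single exceptional point of the zero-derivative arguments. The dilogarithm identity
  enters because differentiating the four trilogarithms gives dilogarithms with different rational
  coefficients; modulo logarithms it says that two differences of dilogarithms agree, which leaves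
  one common combination.\<close>

lemma polylog_Suc_0: "polylog (Suc k) 0 = 0"
  by (induction k) auto

text \<open>Along the segment from 0 to z the derivative of g(t z) in t is
  \<open>polylog (Suc k)\<close> at t z divided by t, so the recursion becomes the fundamental
  theorem of calculus. Only derivatives within \<open>S\<close> and off a finite set are asked for,
  so that the segment may run along the cut and through the branch point 1.\<close>

lemma polylog_Suc_Suc_eq_primitive:
  assumes "finite K" and cont: "continuous_on S g"
    and ray: "\<And>t. t \<in> {0..1} \<Longrightarrow> of_real t * z \<in> S"
    and der: "\<And>u. u \<in> S \<Longrightarrow> u \<noteq> 0 \<Longrightarrow> u \<notin> K \<Longrightarrow>
      (g has_field_derivative polylog (Suc k) u / u) (at u within S)"
  shows "polylog (Suc (Suc k)) z = g z - g 0"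
proof (cases "z = 0")
  case True
  then show ?thesis using polylog_Suc_0 by simp
next
  case False
  define f where "f = (\<lambda>t::real. of_real t * z)"
  have inj: "inj f"
    using False by (auto simp: inj_on_def f_def)
  have "((\<lambda>t. polylog (Suc k) (of_real t * z) / of_real t) has_integral ((g \<circ> f) 1 - (g \<circ> f) 0)) {0..1}"
  proof (rule fundamental_theorem_of_calculus_interior_strong[of "f -` K"])
    show "finite (f -` K)"
      using \<open>finite K\<close> inj by (rule finite_vimageI)
    show "continuous_on {0..1} (g \<circ> f)"
      by (rule continuous_on_compose2[OF cont, of _ f, folded comp_def])
         (use ray in \<open>auto simp: f_def intro!: continuous_intros\<close>)
    fix t :: real assume t: "t \<in> {0<..<1} - f -` K"
    have fv: "(f has_vector_derivative z) (at t within {0..1})"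
      using bounded_linear_imp_has_derivative[OF bounded_linear_scaleR_left[of z]]
      by (simp add: f_def has_vector_derivative_def scaleR_conv_of_real)
    have "(g has_field_derivative polylog (Suc k) (f t) / f t) (at (f t) within f ` {0..1})"
    proof (rule DERIV_subset)
      show "(g has_field_derivative polylog (Suc k) (f t) / f t) (at (f t) within S)"
        using der[of "f t"] ray[of t] t False by (auto simp: f_def)
    qed (use ray in \<open>auto simp: f_def\<close>)
    from field_vector_diff_chain_within[OF fv this]
    have "((g \<circ> f) has_vector_derivative polylog (Suc k) (of_real t * z) / of_real t) (at t within {0..1})"
      using False by (simp add: f_def)
    then show "((g \<circ> f) has_vector_derivative polylog (Suc k) (of_real t * z) / of_real t) (at t)"
      using t at_within_interior[of t "{0..1::real}"] by simp
  qed simp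
  then show ?thesis
    by (simp add: f_def integral_unique)
qed

definition slit_plane :: "complex set"
  where "slit_plane = {z. 1 - z \<notin> \<real>\<^sub>\<le>\<^sub>0}"

lemma slit_plane_iff: "z \<in> slit_plane \<longleftrightarrow> Im z \<noteq> 0 \<or> Re z < 1"
  by (auto simp: slit_plane_def complex_nonpos_Reals_iff)

lemma open_slit_plane: "open slit_plane"
proof -
  have "slit_plane = (\<lambda>z. 1 - z) -` (- \<real>\<^sub>\<le>\<^sub>0)"
    by (auto simp: slit_plane_def)
  also have "open \<dots>"
    by (intro open_vimage continuous_intros) auto
  finally show ?thesis .
qed

lemma slit_plane_ray:
  assumes "z \<in> slit_plane" "t \<in> {0..1}" shows "of_real t * z \<in> slit_plane"
proof -
  have "t * Re z < 1" if "Re z < 1"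
    using that assms(2) mult_left_le_one_le[of "Re z" t] mult_nonneg_nonpos[of t "Re z"]
    by (cases "Re z \<ge> 0") auto
  then show ?thesis
    using assms by (cases "t = 0") (auto simp: slit_plane_iff)
qed

lemma starlike_slit_plane: "starlike slit_plane"
  unfolding starlike_def
proof (rule bexI[of _ 0], intro ballI subsetI)
  fix z u assume "z \<in> slit_plane" "u \<in> closed_segment 0 z"
  then show "u \<in> slit_plane"
    using slit_plane_ray[of z] by (auto simp: closed_segment_def scaleR_conv_of_real)
qed (simp add: slit_plane_iff)

lemma continuous_at_divide_self:
  fixes f :: "complex \<Rightarrow> complex"
  assumes "(f has_field_derivative 1) (at 0)" "f 0 = 0"
  shows "isCont (\<lambda>u. if u = 0 then 1 else f u / u) 0"
proof -
  have "((\<lambda>u. f u / u) \<longlongrightarrow> 1) (at 0)"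
    using assms by (simp add: has_field_derivative_iff)
  then have "((\<lambda>u. if u = 0 then 1 else f u / u) \<longlongrightarrow> 1) (at 0)"
    by (rule Lim_transform_eventually) (simp add: eventually_at_filter)
  then show ?thesis by (simp add: isCont_def)
qed

text \<open>The slit plane is star-shaped about 0, which gives primitives of holomorphic functions.
  The quotient by z is completed at 0 by its limit 1, and the primitive tolerates this one point
  where only continuity is shown.\<close>

lemma polylog_primitive:
  assumes diff: "\<And>u. u \<in> slit_plane \<Longrightarrow> (polylog (Suc k) has_field_derivative f' u) (at u)"
    and f'0: "f' 0 = 1"
  obtains g where "\<And>z. z \<in> slit_plane \<Longrightarrow>
     (g has_field_derivative (if z = 0 then 1 else polylog (Suc k) z / z)) (at z)"
     "\<And>z. z \<in> slit_plane \<Longrightarrow> polylog (Suc (Suc k)) z = g z - g 0"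
proof -
  let ?h = "\<lambda>u. if u = 0 then 1 else polylog (Suc k) u / u"
  have "isCont ?h 0"
    using diff[of 0] f'0 by (intro continuous_at_divide_self) (auto simp: slit_plane_iff polylog_Suc_0)
  moreover have d: "?h field_differentiable at u" if "u \<in> slit_plane" "u \<noteq> 0" for u
  proof -
    have "((\<lambda>u. polylog (Suc k) u / u) has_field_derivative
            (f' u * u - polylog (Suc k) u * 1) / (u * u)) (at u)"
      using that by (auto intro!: derivative_eq_intros diff)
    then have "(?h has_field_derivative (f' u * u - polylog (Suc k) u * 1) / (u * u)) (at u)"
      by (rule has_field_derivative_transform_within_open[where S = "-{0}"]) (use that in auto)
    then show ?thesis by (auto simp: field_differentiable_def)
  qed
  ultimately have "continuous_on slit_plane ?h"
    by (intro continuous_at_imp_continuous_on) (metis field_differentiable_imp_continuous_at)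
  then obtain g where g: "\<forall>z\<in>slit_plane. (g has_field_derivative ?h z) (at z)"
    using holomorphic_starlike_primitive[OF _ starlike_slit_plane open_slit_plane, of ?h "{0}"] d
    by blast
  show ?thesis
  proof (rule that[of g])
    fix z assume z: "z \<in> slit_plane"
    show "polylog (Suc (Suc k)) z = g z - g 0"
    proof (rule polylog_Suc_Suc_eq_primitive[of "{}" slit_plane])
      show "continuous_on slit_plane g"
        using g by (meson DERIV_isCont continuous_at_imp_continuous_on)
      fix u assume "u \<in> slit_plane" "u \<noteq> 0"
      then show "(g has_field_derivative polylog (Suc k) u / u) (at u within slit_plane)"
        using has_field_derivative_at_within g by (metis (full_types))
    qed (use z slit_plane_ray in auto)
  qed (use g in blast)
qed

lemma has_field_derivative_polylog_1:
  assumes "z \<in> slit_plane"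
  shows "(polylog (Suc 0) has_field_derivative 1 / (1 - z)) (at z)"
proof -
  have "polylog (Suc 0) = (\<lambda>z. - Ln (1 - z))" by auto
  then show ?thesis
    using assms by (auto simp: slit_plane_def divide_simps intro!: derivative_eq_intros)
qed

lemma has_field_derivative_polylog_2:
  assumes "z \<in> slit_plane"
  shows "(polylog 2 has_field_derivative (if z = 0 then 1 else - Ln (1 - z) / z)) (at z)"
proof -
  obtain g where g: "\<And>z. z \<in> slit_plane \<Longrightarrow>
     (g has_field_derivative (if z = 0 then 1 else polylog (Suc 0) z / z)) (at z)"
     "\<And>z. z \<in> slit_plane \<Longrightarrow> polylog (Suc (Suc 0)) z = g z - g 0"
    using polylog_primitive[of 0 "\<lambda>z. 1 / (1 - z)"] has_field_derivative_polylog_1 by auto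
  have "((\<lambda>z. g z - g 0) has_field_derivative (if z = 0 then 1 else - Ln (1 - z) / z)) (at z)"
    using g(1)[OF assms] by (auto intro!: derivative_eq_intros)
  then show ?thesis
    by (rule has_field_derivative_transform_within_open[OF _ open_slit_plane assms])
       (simp add: g(2) numeral_2_eq_2 del: polylog.simps)
qed

text \<open>The simple zero of Ln z at 1 beats the logarithmic growth of Ln (1 - z). This is what
  makes the dilogarithm, and later the products with log w, continuous at the branch point.\<close>

lemma tendsto_Ln_mult_Ln: "((\<lambda>z. Ln z * Ln (1 - z)) \<longlongrightarrow> 0) (at 1)"
proof -
  have "(Ln has_field_derivative 1) (at (1::complex))"
    by (auto intro!: derivative_eq_intros)
  then have 1: "((\<lambda>z. Ln z / (z - 1)) \<longlongrightarrow> 1) (at (1::complex))"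
    by (simp add: has_field_derivative_iff)
  have "((\<lambda>u::complex. u * Ln u) \<longlongrightarrow> 0) (at 0)"
  proof (rule Lim_null_comparison)
    \<comment> \<open>The imaginary part of Ln u is bounded by pi, so the limit reduces to that of x
      ln x at 0 over the reals.\<close>
    show "\<forall>\<^sub>F u in at 0. norm (u * Ln u) \<le> norm u * \<bar>ln (norm u)\<bar> + norm u * pi"
    proof (rule eventually_at_filter[THEN iffD2], rule eventuallyI, intro impI)
      fix u :: complex assume "u \<noteq> 0"
      then have "norm (Ln u) \<le> \<bar>ln (norm u)\<bar> + pi"
        using cmod_le[of "Ln u"] Im_Ln_le_pi[of u] mpi_less_Im_Ln[of u] by (simp add: abs_le_iff)
      then show "norm (u * Ln u) \<le> norm u * \<bar>ln (norm u)\<bar> + norm u * pi"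
        by (metis mult_left_mono norm_ge_zero norm_mult distrib_left)
    qed
    have "((\<lambda>x::real. x * \<bar>ln x\<bar> + x * pi) \<longlongrightarrow> 0) (at_right 0)"
      by real_asymp
    moreover have "filterlim (norm :: complex \<Rightarrow> real) (at_right 0) (at 0)"
      unfolding filterlim_at by (auto simp: eventually_at_filter intro!: tendsto_eq_intros)
    ultimately show "((\<lambda>u::complex. norm u * \<bar>ln (norm u)\<bar> + norm u * pi) \<longlongrightarrow> 0) (at 0)"
      by (rule filterlim_compose)
  qed
  moreover have "filterlim (\<lambda>z::complex. 1 - z) (at 0) (at 1)"
    unfolding filterlim_at by (auto simp: eventually_at_filter intro!: tendsto_eq_intros)
  ultimately have 2: "((\<lambda>z::complex. (1 - z) * Ln (1 - z)) \<longlongrightarrow> 0) (at 1)"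
    by (rule filterlim_compose)
  have "((\<lambda>z. - (Ln z / (z - 1)) * ((1 - z) * Ln (1 - z))) \<longlongrightarrow> - 1 * 0) (at (1::complex))"
    by (intro tendsto_intros 1 2)
  then have "((\<lambda>z. - (Ln z / (z - 1)) * ((1 - z) * Ln (1 - z))) \<longlongrightarrow> 0) (at (1::complex))"
    by simp
  then show ?thesis
    by (rule Lim_transform_eventually) (auto simp: eventually_at_filter field_simps)
qed

subsection \<open>Dilogarithm and trilogarithm up to the cut\<close>

abbreviation lower_half :: "complex set"
  where "lower_half \<equiv> {z. Im z \<le> 0}"

text \<open>For Im z <= 0 the point - i (1 - z) has real part - Im z >= 0, so it avoids the cut of
  Ln unless z = 1. Rotating by - pi/2 and adding i pi/2 back therefore expresses Ln (1 - z) by a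
  function that is differentiable even at real z > 1.\<close>

lemma has_field_derivative_Ln_one_minus:
  assumes "z \<in> lower_half" "z \<noteq> 1"
  shows "((\<lambda>z. Ln (1 - z)) has_field_derivative - 1 / (1 - z)) (at z within lower_half)"
proof (rule has_field_derivative_transform_within)
  show "((\<lambda>z. Ln (- \<i> * (1 - z)) + \<i> * of_real (pi / 2)) has_field_derivative - 1 / (1 - z))
          (at z within lower_half)"
  proof -
    have "- \<i> * (1 - z) \<notin> \<real>\<^sub>\<le>\<^sub>0"
      using assms by (auto simp: complex_nonpos_Reals_iff complex_eq_iff)
    then show ?thesis
      using assms by (auto intro!: derivative_eq_intros simp: field_simps)
  qed
  fix u assume u: "u \<in> lower_half" "dist u z < dist z 1"
  then have nz: "- \<i> * (1 - u) \<noteq> 0"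
    by (auto simp: dist_commute)
  have Im: "\<bar>Im (Ln (- \<i> * (1 - u)))\<bar> \<le> pi / 2"
    using u Re_Ln_pos_le[OF nz] by simp
  have "exp (\<i> * of_real (pi / 2)) = \<i>"
    using cis_pi_half unfolding cis_conv_exp .
  then have exp: "exp (Ln (- \<i> * (1 - u)) + \<i> * of_real (pi / 2)) = 1 - u"
    using nz by (simp add: exp_add algebra_simps)
  show "Ln (- \<i> * (1 - u)) + \<i> * of_real (pi / 2) = Ln (1 - u)"
  proof (rule Ln_unique[symmetric, OF exp])
    have Im_add: "Im (Ln (- \<i> * (1 - u)) + \<i> * of_real (pi / 2)) = Im (Ln (- \<i> * (1 - u))) + pi / 2"
      by simp
    show "- pi < Im (Ln (- \<i> * (1 - u)) + \<i> * of_real (pi / 2))"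
      using Im pi_gt_zero unfolding Im_add by linarith
    show "Im (Ln (- \<i> * (1 - u)) + \<i> * of_real (pi / 2)) \<le> pi"
      using Im unfolding Im_add by linarith
  qed
qed (use assms in auto)

text \<open>Euler's reflection formula for Li_2(z) without its constant Li_2(1) = pi^2/6.\<close>

definition dilog_reflected :: "complex \<Rightarrow> complex"
  where "dilog_reflected z = - (Ln z * Ln (1 - z)) - polylog 2 (1 - z)"

lemma polylog_2_0: "polylog 2 0 = 0"
  by (simp add: numeral_2_eq_2)

text \<open>For Re z > 0 the point 1 - z stays off the cut, so Li_2(1 - z) is differentiable even
  when z lies on it. The derivative of Ln (1 - z) is a hypothesis because it is two-sided in the
  slit plane but only one-sided on the cut.\<close>

lemma has_field_derivative_dilog_reflected:
  assumes "Re z > 0" "z \<noteq> 1"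
    and Ln: "((\<lambda>z. Ln (1 - z)) has_field_derivative - 1 / (1 - z)) (at z within S)"
  shows "(dilog_reflected has_field_derivative - Ln (1 - z) / z) (at z within S)"
proof -
  have "1 - z \<in> slit_plane"
    using assms by (auto simp: slit_plane_iff)
  then have *: "((polylog 2 \<circ> (\<lambda>z. 1 - z)) has_field_derivative
      (- Ln (1 - (1 - z)) / (1 - z)) * (- 1)) (at z within S)"
    using has_field_derivative_polylog_2[of "1 - z"] assms(2)
    by (intro DERIV_image_chain[where g = "\<lambda>z. 1 - z", OF has_field_derivative_at_within])
       (auto intro!: derivative_eq_intros)
  have "(Ln has_field_derivative inverse z) (at z within S)"
    using assms(1) by (intro has_field_derivative_at_within[OF has_field_derivative_Ln])
       (auto simp: complex_nonpos_Reals_iff)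
  from DERIV_cong[OF DERIV_diff[OF DERIV_minus[OF DERIV_mult[OF this Ln]] *]]
  show ?thesis
    unfolding dilog_reflected_def [abs_def] comp_def by (simp add: divide_inverse mult.commute)
qed

lemma isCont_dilog_reflected_1: "isCont dilog_reflected 1"
proof -
  have "((\<lambda>z. Ln z * Ln (1 - z)) \<longlongrightarrow> Ln 1 * Ln (1 - 1)) (at (1::complex))"
    using tendsto_Ln_mult_Ln by simp
  moreover have "isCont (polylog 2) (1 - 1 :: complex)"
    using DERIV_isCont[OF has_field_derivative_polylog_2[of 0]] by (simp add: slit_plane_iff)
  then have "isCont (\<lambda>z. polylog 2 (1 - z)) (1::complex)"
    by (rule isCont_o2[where g = "polylog 2", rotated]) (auto intro!: continuous_intros)
  ultimately show ?thesis
    unfolding dilog_reflected_def[abs_def] isCont_def by (rule tendsto_diff[OF tendsto_minus])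
qed

lemma has_field_derivative_Ln_one_minus_slit_plane:
  assumes "z \<in> slit_plane"
  shows "((\<lambda>z. Ln (1 - z)) has_field_derivative - 1 / (1 - z)) (at z)"
  using assms by (auto simp: slit_plane_def divide_simps intro!: derivative_eq_intros)

lemma dilog_reflection_slit_plane:
  obtains c where "\<And>z. Re z > 0 \<Longrightarrow> z \<in> slit_plane \<Longrightarrow> polylog 2 z = c + dilog_reflected z"
proof -
  let ?A = "{z::complex. 0 < Re z} \<inter> {z. Re z < 1}"
    and ?B = "{z::complex. 0 < Re z} \<inter> {z. Im z > 0}"
    and ?C = "{z::complex. 0 < Re z} \<inter> {z. Im z < 0}"
  define V where "V = {z. Re z > 0} \<inter> slit_plane"
  \<comment> \<open>Three convex pieces cover the right half of the slit plane; the points 1/2 + i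
    and 1/2 - i show that they overlap.\<close>
  have "Complex (1/2) 1 \<in> ?A \<inter> ?B" "Complex (1/2) (-1) \<in> (?A \<union> ?B) \<inter> ?C"
    by auto
  then have "connected ((?A \<union> ?B) \<union> ?C)"
    by (intro connected_Un convex_connected convex_Int convex_halfspace_Re_gt convex_halfspace_Re_lt
        convex_halfspace_Im_gt convex_halfspace_Im_lt) blast+
  moreover have "(?A \<union> ?B) \<union> ?C = V"
    by (auto simp: V_def slit_plane_iff)
  ultimately have "connected V" by simp
  moreover have "open V"
    unfolding V_def by (intro open_Int open_slit_plane open_halfspace_Re_gt)
  moreover have D: "((\<lambda>z. polylog 2 z - dilog_reflected z) has_field_derivative 0) (at z)" if "z \<in> V" for z
  proof -
    have "(polylog 2 has_field_derivative - Ln (1 - z) / z) (at z)"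
      using has_field_derivative_polylog_2[of z] that by (auto simp: V_def split: if_splits)
    moreover have "(dilog_reflected has_field_derivative - Ln (1 - z) / z) (at z)"
      using that by (intro has_field_derivative_dilog_reflected has_field_derivative_Ln_one_minus_slit_plane)
        (auto simp: V_def slit_plane_iff)
    ultimately show ?thesis
      using DERIV_diff by fastforce
  qed
  moreover have "continuous_on V (\<lambda>z. polylog 2 z - dilog_reflected z)"
    using D by (meson DERIV_isCont continuous_at_imp_continuous_on)
  ultimately have "(\<lambda>z. polylog 2 z - dilog_reflected z) constant_on V"
    using DERIV_zero_connected_constant_on[of V "{}"] by blast
  then obtain c where "\<And>z. z \<in> V \<Longrightarrow> polylog 2 z - dilog_reflected z = c"
    by (auto simp: constant_on_def)
  then show ?thesis
    using that[of c] by (fastforce simp: V_def)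
qed

text \<open>On the cut the path of integration from 0 to z runs through the branch point 1, where the
  reflected expression is still continuous; so the same constant works there.\<close>

lemma dilog_reflection:
  obtains c where "\<And>z. Re z > 0 \<Longrightarrow> polylog 2 z = c + dilog_reflected z"
proof -
  obtain c where c: "\<And>z. Re z > 0 \<Longrightarrow> z \<in> slit_plane \<Longrightarrow> polylog 2 z = c + dilog_reflected z"
    using dilog_reflection_slit_plane by blast
  \<comment> \<open>On the cut nothing is known yet about \<open>polylog 2\<close>, so the candidate
    primitive takes the reflected expression there; the two definitions agree on the overlap by the
    choice of c.\<close>
  define g where "g = (\<lambda>u. if u \<in> slit_plane then polylog 2 u else c + dilog_reflected u)"
  have g_right: "g u = c + dilog_reflected u" if "Re u > 0" for u
    using c that by (auto simp: g_def)
  have g_slit: "(g has_field_derivative (if u = 0 then 1 else - Ln (1 - u) / u)) (at u)"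
    if "u \<in> slit_plane" for u
    by (rule has_field_derivative_transform_within_open[OF has_field_derivative_polylog_2 open_slit_plane])
       (use that in \<open>auto simp: g_def\<close>)
  have g_der: "(g has_field_derivative (if u = 0 then 1 else - Ln (1 - u) / u)) (at u within lower_half)"
    if u: "u \<in> lower_half" "u \<noteq> 1" for u
  proof (cases "u \<in> slit_plane")
    case True
    then show ?thesis using g_slit has_field_derivative_at_within by blast
  next
    case False
    then have Re: "Re u > 0" by (auto simp: slit_plane_iff)
    have "((\<lambda>u. c + dilog_reflected u) has_field_derivative - Ln (1 - u) / u) (at u within lower_half)"
      using has_field_derivative_dilog_reflected[OF Re u(2) has_field_derivative_Ln_one_minus[OF u]]
      by (auto intro!: derivative_eq_intros)
    then have "(g has_field_derivative - Ln (1 - u) / u) (at u within lower_half)"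
    proof (rule has_field_derivative_transform_within[OF _ Re u(1)])
      fix x assume "dist x u < Re u"
      then have "Re x > 0"
        using abs_Re_le_cmod[of "x - u"] by (auto simp: dist_norm)
      then show "c + dilog_reflected x = g x"
        by (simp add: g_right)
    qed
    then show ?thesis using Re by auto
  qed
  have "isCont (\<lambda>u. c + dilog_reflected u) 1"
    by (intro continuous_intros isCont_dilog_reflected_1)
  moreover have "eventually (\<lambda>u. u \<in> {u. Re u > 0}) (nhds (1::complex))"
    by (intro eventually_nhds_in_open open_halfspace_Re_gt) auto
  then have "eventually (\<lambda>u. c + dilog_reflected u = g u) (nhds 1)"
    by eventually_elim (simp add: g_right)
  ultimately have "isCont g 1"
    by (rule iffD1[OF isCont_cong, rotated])
  then have cont: "continuous_on lower_half g"
    using g_der unfolding continuous_on_eq_continuous_within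
    by (metis DERIV_continuous continuous_at_imp_continuous_within)
  show ?thesis
  proof (rule that[of c])
    fix z :: complex assume z: "Re z > 0"
    show "polylog 2 z = c + dilog_reflected z"
    proof (cases "z \<in> slit_plane")
      case False
      then have "polylog (Suc (Suc 0)) z = g z - g 0"
      \<comment> \<open>Outside the slit plane z is real and at least 1, so its segment from 0 lies
        in \<open>lower_half\<close> and meets the exceptional point 1.\<close>
      proof (intro polylog_Suc_Suc_eq_primitive[of "{1}" lower_half] cont)
        fix u assume "u \<in> lower_half" "u \<noteq> 0" "u \<notin> {1}"
        then show "(g has_field_derivative polylog (Suc 0) u / u) (at u within lower_half)"
          using g_der[of u] by simp
      qed (auto simp: slit_plane_iff)
      then show ?thesis
        using g_right[OF z] by (simp add: g_def slit_plane_iff polylog_2_0 numeral_2_eq_2 [symmetric] del: polylog.simps)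
    qed (use c z in auto)
  qed
qed

lemma isCont_polylog_2_1: "isCont (polylog 2) 1"
proof -
  obtain c where c: "\<And>z. Re z > 0 \<Longrightarrow> polylog 2 z = c + dilog_reflected z"
    using dilog_reflection by blast
  have "isCont (\<lambda>u. c + dilog_reflected u) 1"
    by (intro continuous_intros isCont_dilog_reflected_1)
  moreover have "eventually (\<lambda>u. u \<in> {u. Re u > 0}) (nhds (1::complex))"
    by (intro eventually_nhds_in_open open_halfspace_Re_gt) auto
  then have "eventually (\<lambda>u. c + dilog_reflected u = polylog 2 u) (nhds 1)"
    by eventually_elim (simp add: c)
  ultimately show ?thesis
    by (rule iffD1[OF isCont_cong, rotated])
qed

text \<open>On the cut Li_2 jumps but is the limit from below, so the derivative exists only from
  that side; the reflected expression supplies it.\<close>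

lemma has_field_derivative_polylog_2_lower_half:
  assumes z: "z \<in> lower_half" "z \<noteq> 1"
  shows "(polylog 2 has_field_derivative (if z = 0 then 1 else - Ln (1 - z) / z)) (at z within lower_half)"
proof (cases "z \<in> slit_plane")
  case True
  then show ?thesis using has_field_derivative_polylog_2 has_field_derivative_at_within by blast
next
  case False
  obtain c where c: "\<And>z. Re z > 0 \<Longrightarrow> polylog 2 z = c + dilog_reflected z"
    using dilog_reflection by blast
  from False have Re: "Re z > 0" by (auto simp: slit_plane_iff)
  have "((\<lambda>u. c + dilog_reflected u) has_field_derivative - Ln (1 - z) / z) (at z within lower_half)"
    using has_field_derivative_dilog_reflected[OF Re z(2) has_field_derivative_Ln_one_minus[OF z]]
    by (auto intro!: derivative_eq_intros)
  then have "(polylog 2 has_field_derivative - Ln (1 - z) / z) (at z within lower_half)"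
  proof (rule has_field_derivative_transform_within[OF _ Re z(1)])
    fix x assume "dist x z < Re z"
    then have "Re x > 0"
      using abs_Re_le_cmod[of "x - z"] by (auto simp: dist_norm)
    then show "c + dilog_reflected x = polylog 2 x"
      by (simp add: c)
  qed
  then show ?thesis using Re by auto
qed

lemma continuous_on_polylog_2_lower_half: "continuous_on lower_half (polylog 2)"
  unfolding continuous_on_eq_continuous_within
  by (metis DERIV_continuous continuous_at_imp_continuous_within
      has_field_derivative_polylog_2_lower_half isCont_polylog_2_1)

text \<open>This half plane meets the cut only in the branch point 1, the value of (1 + w)/2 at w =
  1.\<close>

lemma continuous_on_polylog_2_left: "continuous_on {z. Re z \<le> 1} (polylog 2)"
proof (rule continuous_at_imp_continuous_on, safe)
  fix z :: complex assume "Re z \<le> 1"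
  then have "z \<in> slit_plane \<or> z = 1"
    by (auto simp: slit_plane_iff complex_eq_iff)
  then show "isCont (polylog 2) z"
    using has_field_derivative_polylog_2 DERIV_isCont isCont_polylog_2_1 by blast
qed

text \<open>A function continuous on a convex set and holomorphic in its interior has a primitive up
  to the boundary, so Li_3 is differentiable within \<open>S\<close> even at boundary points on the
  cut. The set is left general to serve both \<open>lower_half\<close> and the half plane Re z <=
  1.\<close>

lemma has_field_derivative_polylog_3:
  assumes "convex S" "0 \<in> S" "z \<in> S"
    and cont: "continuous_on S (polylog 2)" and int: "interior S \<subseteq> slit_plane"
  shows "(polylog 3 has_field_derivative (if z = 0 then 1 else polylog 2 z / z)) (at z within S)"
proof -
  let ?h = "\<lambda>u. if u = 0 then 1 else polylog 2 u / u"
  have "isCont ?h 0"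
    using has_field_derivative_polylog_2[of 0]
    by (intro continuous_at_divide_self) (auto simp: slit_plane_iff polylog_2_0)
  moreover have "continuous (at u within S) ?h" if "u \<in> S" "u \<noteq> 0" for u
  proof -
    have "continuous (at u within S) (\<lambda>u. polylog 2 u / u)"
      using that cont by (auto intro!: continuous_intros simp: continuous_on_eq_continuous_within)
    then show ?thesis
      by (rule continuous_transform_within[of _ _ _ "norm u"]) (use that in auto)
  qed
  ultimately have "continuous (at u within S) ?h" if "u \<in> S" for u
    using that by (cases "u = 0") (auto intro: continuous_at_imp_continuous_within)
  then have h_cont: "continuous_on S ?h"
    by (simp add: continuous_on_eq_continuous_within)
  have h_diff: "?h field_differentiable at u" if "u \<in> interior S - {0}" for u
  proof -
    have u: "u \<in> slit_plane" "u \<noteq> 0" using that int by auto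
    have "((\<lambda>u. polylog 2 u / u) has_field_derivative
            ((- Ln (1 - u) / u) * u - polylog 2 u * 1) / (u * u)) (at u)"
      using u has_field_derivative_polylog_2[of u] by (auto intro!: derivative_eq_intros)
    then have "(?h has_field_derivative ((- Ln (1 - u) / u) * u - polylog 2 u * 1) / (u * u)) (at u)"
      by (rule has_field_derivative_transform_within_open[where S = "-{0}"]) (use u in auto)
    then show ?thesis by (auto simp: field_differentiable_def)
  qed
  obtain g where g: "\<And>x. x \<in> S \<Longrightarrow> (g has_field_derivative ?h x) (at x within S)"
    using holomorphic_convex_primitive[OF \<open>convex S\<close> _ h_cont h_diff] by blast
  have eq: "polylog 3 u = g u - g 0" if u: "u \<in> S" for u
  proof -
    have "polylog (Suc (Suc (Suc 0))) u = g u - g 0"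
    proof (rule polylog_Suc_Suc_eq_primitive[of "{}" S])
      show "continuous_on S g"
        using g by (meson DERIV_continuous continuous_on_eq_continuous_within)
      fix t :: real assume "t \<in> {0..1}"
      then show "of_real t * u \<in> S"
        using convexD_alt[OF \<open>convex S\<close> \<open>0 \<in> S\<close> u, of t] by (auto simp: scaleR_conv_of_real)
    next
      fix v assume "v \<in> S" "v \<noteq> 0"
      then show "(g has_field_derivative polylog (Suc (Suc 0)) v / v) (at v within S)"
        using g[of v] by (simp add: numeral_2_eq_2 del: polylog.simps)
    qed auto
    then show ?thesis by (simp add: numeral_3_eq_3 del: polylog.simps)
  qed
  have "((\<lambda>u. g u - g 0) has_field_derivative ?h z) (at z within S)"
    using g[OF \<open>z \<in> S\<close>] by (auto intro!: derivative_eq_intros)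
  then show ?thesis
    by (rule has_field_derivative_transform_within[OF _ zero_less_one \<open>z \<in> S\<close>]) (simp add: eq)
qed

lemma has_field_derivative_polylog_3_lower_half:
  assumes "z \<in> lower_half"
  shows "(polylog 3 has_field_derivative (if z = 0 then 1 else polylog 2 z / z)) (at z within lower_half)"
proof (rule has_field_derivative_polylog_3)
  have "interior lower_half = {z. Im z < 0}"
    using interior_halfspace_le[of "- \<i>" 0] interior_halfspace_le[of "\<i>" 0] by (simp add: inner_complex_def)
  then show "interior lower_half \<subseteq> slit_plane"
    by (auto simp: slit_plane_iff)
qed (use assms continuous_on_polylog_2_lower_half convex_halfspace_Im_le in auto)

lemma has_field_derivative_polylog_3_left:
  assumes "Re z \<le> 1"
  shows "(polylog 3 has_field_derivative (if z = 0 then 1 else polylog 2 z / z)) (at z within {z. Re z \<le> 1})"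
proof (rule has_field_derivative_polylog_3)
  have "interior {z. Re z \<le> 1} = {z. Re z < 1}"
    using interior_halfspace_le[of "1::complex" 1] by (simp add: inner_complex_def)
  then show "interior {z. Re z \<le> 1} \<subseteq> slit_plane"
    by (auto simp: slit_plane_iff)
qed (use assms continuous_on_polylog_2_left convex_halfspace_Re_le in auto)

subsection \<open>The four arguments on the quarter disc\<close>

lemma has_field_derivative_chain_within:
  assumes "(f has_field_derivative f') (at (g x) within B)" "g ` A \<subseteq> B"
    and "(g has_field_derivative g') (at x within A)" "f' * g' = D"
  shows "((\<lambda>x. f (g x)) has_field_derivative D) (at x within A)"
  using DERIV_image_chain[OF DERIV_subset[OF assms(1,2)] assms(3)] assms(4) by (simp add: comp_def)

text \<open>The conditions on w that do not mention 1 - w^2. The remaining bound says |y| <= 1 and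
  is imposed on the side of the series; the present set is convex, as the zero-derivative arguments
  require.\<close>

definition quarter_disc :: "complex set"
  where "quarter_disc = {w. Re w > 0 \<and> Im w \<ge> 0 \<and> norm w \<le> 1}"

lemma convex_quarter_disc: "convex quarter_disc"
proof -
  have *: "quarter_disc = {w. Re w > 0} \<inter> {w. Im w \<ge> 0} \<inter> cball 0 1"
    by (auto simp: quarter_disc_def)
  show ?thesis
    unfolding * by (intro convex_Int convex_halfspace_Re_gt convex_halfspace_Im_ge convex_cball)
qed

lemma quarter_disc_Re_less_1:
  assumes "w \<in> quarter_disc" "w \<noteq> 1" shows "Re w < 1"
proof (rule ccontr)
  assume "\<not> Re w < 1"
  moreover have "Re w \<le> 1"
    using assms abs_Re_le_cmod[of w] by (auto simp: quarter_disc_def)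
  ultimately have "Re w = 1" by simp
  moreover from this have "Im w = 0"
    using assms by (auto simp: quarter_disc_def cmod_def real_sqrt_le_1_iff)
  ultimately show False using assms by (simp add: complex_eq_iff)
qed

lemma quarter_disc_inverse:
  assumes "w \<in> quarter_disc"
  shows "w \<noteq> 0" "Re (1 / w) > 0" "Im (1 / w) \<le> 0"
  using assms by (auto simp: quarter_disc_def Re_divide Im_divide power2_eq_square add_pos_nonneg)

lemma quarter_disc_Re_le_1: "w \<in> quarter_disc \<Longrightarrow> Re w \<le> 1"
  using quarter_disc_Re_less_1[of w] by force

text \<open>Each argument stays in a half plane where the one-sided derivatives of Li_3 are
  available; only (1 + 1/w)/2 can reach the cut beyond 1.\<close>

lemma quarter_disc_images:
  "(\<lambda>w. (1 + w) / 2) ` quarter_disc \<subseteq> {z. Re z \<le> 1}"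
  "(\<lambda>w. (1 - w) / 2) ` quarter_disc \<subseteq> {z. Re z \<le> 1}"
  "(\<lambda>w. (1 - 1 / w) / 2) ` quarter_disc \<subseteq> {z. Re z \<le> 1}"
  "(\<lambda>w. (1 + 1 / w) / 2) ` quarter_disc \<subseteq> lower_half"
proof -
  show "(\<lambda>w. (1 + w) / 2) ` quarter_disc \<subseteq> {z. Re z \<le> 1}"
    using quarter_disc_Re_le_1 by fastforce
  show "(\<lambda>w. (1 - w) / 2) ` quarter_disc \<subseteq> {z. Re z \<le> 1}"
    by (auto simp: quarter_disc_def)
  show "(\<lambda>w. (1 - 1 / w) / 2) ` quarter_disc \<subseteq> {z. Re z \<le> 1}"
    using quarter_disc_inverse(2) by fastforce
  show "(\<lambda>w. (1 + 1 / w) / 2) ` quarter_disc \<subseteq> lower_half"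
    using quarter_disc_inverse(3) by auto
qed

text \<open>Both (1 + w)/2 and w lie in the right half plane, so their arguments differ by less than
  pi and the principal logarithm of the quotient splits.\<close>

lemma Ln_half_one_plus_inverse:
  assumes "w \<in> quarter_disc"
  shows "Ln ((1 + 1/w) / 2) = Ln ((1 + w) / 2) - Ln w"
proof (rule Ln_unique)
  have nz: "w \<noteq> 0" "(1 + w) / 2 \<noteq> 0" and Re: "Re w > 0" "Re ((1 + w) / 2) > 0"
    using assms by (auto simp: quarter_disc_def complex_eq_iff)
  then show "exp (Ln ((1 + w) / 2) - Ln w) = (1 + 1/w) / 2"
    by (simp add: exp_diff field_simps)
  have "\<bar>Im (Ln w)\<bar> < pi / 2" "\<bar>Im (Ln ((1 + w) / 2))\<bar> < pi / 2"
    using Re Re_Ln_pos_lt[OF nz(1)] Re_Ln_pos_lt[OF nz(2)] by blast+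
  then show "- pi < Im (Ln ((1 + w) / 2) - Ln w)" "Im (Ln ((1 + w) / 2) - Ln w) \<le> pi"
    unfolding minus_complex.sel by linarith+
qed

text \<open>The left argument is - ((1 - w)/2) / w. As arg w lies in [0, pi/2) and arg ((1 - w)/2)
  in (- pi/2, 0], the difference of the logarithms has imaginary part in (- pi, 0], and the sign is
  accounted for by + i pi. All terms with pi in the result originate here.\<close>

lemma Ln_half_one_minus_inverse:
  assumes "w \<in> quarter_disc" "w \<noteq> 1"
  shows "Ln ((1 - 1/w) / 2) = Ln ((1 - w) / 2) - Ln w + \<i> * of_real pi"
proof (rule Ln_unique)
  let ?b = "(1 - w) / 2"
  have nz: "w \<noteq> 0" "?b \<noteq> 0" and Re: "Re w > 0" "Re ?b > 0" and Im: "Im w \<ge> 0" "Im ?b \<le> 0"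
    using assms quarter_disc_Re_less_1[OF assms] by (auto simp: quarter_disc_def)
  show "exp (Ln ?b - Ln w + \<i> * of_real pi) = (1 - 1/w) / 2"
    using nz by (simp add: exp_diff exp_add field_simps)
  have le: "\<bar>Im (Ln w)\<bar> < pi / 2" "\<bar>Im (Ln ?b)\<bar> < pi / 2"
    using Re Re_Ln_pos_lt[OF nz(1)] Re_Ln_pos_lt[OF nz(2)] by blast+
  have "Im (Ln w) \<ge> 0"
    using Im Im_Ln_pos_le[OF nz(1)] by blast
  moreover have "Im (Ln ?b) \<le> 0"
    using Im le Im_Ln_pos_lt[OF nz(2)] by linarith
  moreover have "Im (Ln ?b - Ln w + \<i> * of_real pi) = Im (Ln ?b) - Im (Ln w) + pi"
    by simp
  ultimately show "- pi < Im (Ln ?b - Ln w + \<i> * of_real pi)" "Im (Ln ?b - Ln w + \<i> * of_real pi) \<le> pi"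
    using le by linarith+
qed

lemma one_minus_half:
  "1 - (1 + x) / 2 = (1 - x) / 2" "1 - (1 - x) / 2 = (1 + x) / 2" for x :: complex
  by (simp_all add: field_simps)

lemma half_cancel:
  "- y / (x / 2) * (1 / 2) = - y * (1 / x)" "- y / (x / 2) * (- 1 / 2) = y * (1 / x)" for x y :: complex
  by simp_all

lemma half_eq_0_iff: "x / 2 = 0 \<longleftrightarrow> x = 0" for x :: complex
  by simp

context
  fixes w :: complex
  assumes w: "w \<in> quarter_disc"
begin

lemma quarter_disc_nonzero: "w \<noteq> 0" "1 + w \<noteq> 0"
  using w by (auto simp: quarter_disc_def complex_eq_iff)

text \<open>In the lemma names below, a, b, c, d refer to the arguments (1 + w)/2, (1 - w)/2,
  (1 + 1/w)/2, (1 - 1/w)/2.  For real w the point c lies on the cut, so its derivatives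
  are taken within the quarter disc only.\<close>

lemma deriv_a: "((\<lambda>w. (1 + w) / 2) has_field_derivative 1 / 2) (at w within A)"
  by (auto intro!: derivative_eq_intros)

lemma deriv_b: "((\<lambda>w. (1 - w) / 2) has_field_derivative - 1 / 2) (at w within A)"
  by (auto intro!: derivative_eq_intros)

lemma deriv_c: "((\<lambda>w. (1 + 1 / w) / 2) has_field_derivative - 1 / (2 * w\<^sup>2)) (at w within A)"
  using quarter_disc_nonzero by (auto intro!: derivative_eq_intros simp: power2_eq_square)

lemma deriv_d: "((\<lambda>w. (1 - 1 / w) / 2) has_field_derivative 1 / (2 * w\<^sup>2)) (at w within A)"
  using quarter_disc_nonzero by (auto intro!: derivative_eq_intros simp: power2_eq_square)

lemma deriv_Ln: "(Ln has_field_derivative 1 / w) (at w within A)"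
  using w has_field_derivative_at_within[OF has_field_derivative_Ln[of w]]
  by (auto simp: quarter_disc_def complex_nonpos_Reals_iff divide_inverse)

lemma deriv_Ln_a: "((\<lambda>w. Ln ((1 + w) / 2)) has_field_derivative 1 / (1 + w)) (at w within A)"
proof (rule has_field_derivative_chain_within[OF has_field_derivative_Ln _ deriv_a])
  show "(1 + w) / 2 \<notin> \<real>\<^sub>\<le>\<^sub>0"
    using w by (auto simp: quarter_disc_def complex_nonpos_Reals_iff)
qed (use quarter_disc_nonzero in \<open>auto simp: field_simps\<close>)

context
  assumes ne: "w \<noteq> 1"
begin

lemma deriv_Ln_b: "((\<lambda>w. Ln ((1 - w) / 2)) has_field_derivative - 1 / (1 - w)) (at w within A)"
proof (rule has_field_derivative_chain_within[OF has_field_derivative_Ln _ deriv_b])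
  show "(1 - w) / 2 \<notin> \<real>\<^sub>\<le>\<^sub>0"
    using quarter_disc_Re_less_1[OF w ne] by (auto simp: complex_nonpos_Reals_iff)
qed (use ne in \<open>auto simp: field_simps\<close>)

lemma deriv_polylog_2_a:
  "((\<lambda>w. polylog 2 ((1 + w) / 2)) has_field_derivative - Ln ((1 - w) / 2) * (1 / (1 + w))) (at w within A)"
proof (rule has_field_derivative_chain_within[OF has_field_derivative_polylog_2 _ deriv_a])
  show "(1 + w) / 2 \<in> slit_plane"
    using quarter_disc_Re_less_1[OF w ne] by (auto simp: slit_plane_iff)
  show "(if (1 + w) / 2 = 0 then 1 else - Ln (1 - (1 + w) / 2) / ((1 + w) / 2)) * (1 / 2)
      = - Ln ((1 - w) / 2) * (1 / (1 + w))"
    using quarter_disc_nonzero(2) by (simp only: one_minus_half half_eq_0_iff if_False half_cancel)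
qed auto

lemma deriv_polylog_2_b:
  "((\<lambda>w. polylog 2 ((1 - w) / 2)) has_field_derivative Ln ((1 + w) / 2) * (1 / (1 - w))) (at w within A)"
proof (rule has_field_derivative_chain_within[OF has_field_derivative_polylog_2 _ deriv_b])
  show "(1 - w) / 2 \<in> slit_plane"
    using w by (auto simp: slit_plane_iff quarter_disc_def)
  show "(if (1 - w) / 2 = 0 then 1 else - Ln (1 - (1 - w) / 2) / ((1 - w) / 2)) * (- 1 / 2)
      = Ln ((1 + w) / 2) * (1 / (1 - w))"
    using ne by (simp only: one_minus_half half_eq_0_iff right_minus_eq eq_commute[of 1] if_False half_cancel)
qed auto

lemma quarter_disc_inverse_ne: "1 + 1 / w \<noteq> 0" "1 / w \<noteq> 1"
proof -
  have "Re (1 + 1 / w) > 0"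
    using quarter_disc_inverse[OF w] by simp
  then show "1 + 1 / w \<noteq> 0" by force
qed (use ne quarter_disc_nonzero in auto)

lemma d_in_slit_plane: "(1 - 1 / w) / 2 \<in> slit_plane"
  using quarter_disc_inverse[OF w] by (auto simp: slit_plane_iff)

text \<open>These are the logarithmic derivatives of (1 + 1/w)/2 and (1 - 1/w)/2 up to the order of
  the factors. Splitting them makes every later derivative linear in 1/w, 1/(1 + w) and 1/(1 -
  w).\<close>

lemma partial_fractions:
  "1 / ((1 + 1 / w) / 2) * (- 1 / (2 * w\<^sup>2)) = - (1 / w - 1 / (1 + w))"
  "1 / ((1 - 1 / w) / 2) * (1 / (2 * w\<^sup>2)) = - (1 / (1 - w) + 1 / w)"
proof -
  have "1 + w \<noteq> 0" "1 - w \<noteq> 0" "w \<noteq> 0" using quarter_disc_nonzero ne by auto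
  have "(1 + 1 / w) / 2 * (2 * w\<^sup>2) = w * (1 + w)" "(1 - 1 / w) / 2 * (2 * w\<^sup>2) = - (w * (1 - w))"
    using \<open>w \<noteq> 0\<close> by (simp_all add: field_simps power2_eq_square)
  then have "1 / ((1 + 1 / w) / 2) * (- 1 / (2 * w\<^sup>2)) = - (1 / (w * (1 + w)))"
    "1 / ((1 - 1 / w) / 2) * (1 / (2 * w\<^sup>2)) = - (1 / (w * (1 - w)))"
    by (simp_all only: times_divide_times_eq mult_minus_left mult_minus_right
        mult_1 minus_divide_left[symmetric] divide_minus_right)
  moreover have "1 / (w * (1 + w)) = 1 / w - 1 / (1 + w)" "1 / (w * (1 - w)) = 1 / (1 - w) + 1 / w"
    using \<open>1 + w \<noteq> 0\<close> \<open>1 - w \<noteq> 0\<close> \<open>w \<noteq> 0\<close> by (simp_all add: divide_simps)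
  ultimately show "1 / ((1 + 1 / w) / 2) * (- 1 / (2 * w\<^sup>2)) = - (1 / w - 1 / (1 + w))"
    "1 / ((1 - 1 / w) / 2) * (1 / (2 * w\<^sup>2)) = - (1 / (1 - w) + 1 / w)"
    by simp_all
qed

lemma deriv_polylog_2_c:
  "((\<lambda>w. polylog 2 ((1 + 1/w) / 2)) has_field_derivative
     (Ln ((1 - w) / 2) - Ln w + \<i> * of_real pi) * (1 / w - 1 / (1 + w))) (at w within quarter_disc)"
proof (rule has_field_derivative_chain_within[OF has_field_derivative_polylog_2_lower_half quarter_disc_images(4) deriv_c])
  show "(1 + 1 / w) / 2 \<in> lower_half"
    using quarter_disc_images(4) w by blast
  show "(1 + 1 / w) / 2 \<noteq> 1"
    using quarter_disc_inverse_ne by (auto simp: field_simps)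
  have "(if (1 + 1 / w) / 2 = 0 then 1 else - Ln (1 - (1 + 1 / w) / 2) / ((1 + 1 / w) / 2)) * (- 1 / (2 * w\<^sup>2))
     = - Ln ((1 - 1 / w) / 2) * (1 / ((1 + 1 / w) / 2) * (- 1 / (2 * w\<^sup>2)))"
    unfolding one_minus_half using quarter_disc_inverse_ne by simp
  then show "(if (1 + 1 / w) / 2 = 0 then 1 else - Ln (1 - (1 + 1 / w) / 2) / ((1 + 1 / w) / 2)) * (- 1 / (2 * w\<^sup>2))
     = (Ln ((1 - w) / 2) - Ln w + \<i> * of_real pi) * (1 / w - 1 / (1 + w))"
    unfolding partial_fractions Ln_half_one_minus_inverse[OF w ne] by (simp only: minus_mult_minus)
qed

lemma deriv_polylog_2_d:
  "((\<lambda>w. polylog 2 ((1 - 1/w) / 2)) has_field_derivative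
     (Ln ((1 + w) / 2) - Ln w) * (1 / (1 - w) + 1 / w)) (at w within A)"
proof (rule has_field_derivative_chain_within[OF has_field_derivative_polylog_2[OF d_in_slit_plane] _ deriv_d])
  have "(if (1 - 1 / w) / 2 = 0 then 1 else - Ln (1 - (1 - 1 / w) / 2) / ((1 - 1 / w) / 2)) * (1 / (2 * w\<^sup>2))
     = - Ln ((1 + 1 / w) / 2) * (1 / ((1 - 1 / w) / 2) * (1 / (2 * w\<^sup>2)))"
    unfolding one_minus_half using quarter_disc_inverse_ne by simp
  then show "(if (1 - 1 / w) / 2 = 0 then 1 else - Ln (1 - (1 - 1 / w) / 2) / ((1 - 1 / w) / 2)) * (1 / (2 * w\<^sup>2))
     = (Ln ((1 + w) / 2) - Ln w) * (1 / (1 - w) + 1 / w)"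
    unfolding partial_fractions Ln_half_one_plus_inverse[OF w] by (simp only: minus_mult_minus)
qed auto

end

end

lemma deriv_polylog_3:
  assumes w: "w \<in> quarter_disc" "w \<noteq> 1"
  shows
    "((\<lambda>w. polylog 3 ((1 + w) / 2)) has_field_derivative polylog 2 ((1 + w) / 2) * (1 / (1 + w)))
       (at w within quarter_disc)"
    "((\<lambda>w. polylog 3 ((1 - w) / 2)) has_field_derivative - polylog 2 ((1 - w) / 2) * (1 / (1 - w)))
       (at w within quarter_disc)"
    "((\<lambda>w. polylog 3 ((1 + 1/w) / 2)) has_field_derivative
       - polylog 2 ((1 + 1/w) / 2) * (1 / w - 1 / (1 + w))) (at w within quarter_disc)"
    "((\<lambda>w. polylog 3 ((1 - 1/w) / 2)) has_field_derivative
       - polylog 2 ((1 - 1/w) / 2) * (1 / (1 - w) + 1 / w)) (at w within quarter_disc)"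
proof -
  note ne = quarter_disc_nonzero[OF w(1)] quarter_disc_inverse_ne[OF w]
  have cancel: "y / (x / 2) * (1 / 2) = y * (1 / x)" "y / (x / 2) * (- 1 / 2) = - y * (1 / x)"
    "y / x * z = y * (1 / x * z)" "y * - z = - y * z" for x y z :: complex
    by simp_all
  show "((\<lambda>w. polylog 3 ((1 + w) / 2)) has_field_derivative polylog 2 ((1 + w) / 2) * (1 / (1 + w)))
       (at w within quarter_disc)"
  proof (rule has_field_derivative_chain_within[OF has_field_derivative_polylog_3_left
        quarter_disc_images(1) deriv_a])
    show "Re ((1 + w) / 2) \<le> 1" using quarter_disc_images(1) w by blast
    show "(if (1 + w) / 2 = 0 then 1 else polylog 2 ((1 + w) / 2) / ((1 + w) / 2)) * (1 / 2)
        = polylog 2 ((1 + w) / 2) * (1 / (1 + w))"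
      using ne by (simp only: half_eq_0_iff if_False cancel(1))
  qed (fact w)
  show "((\<lambda>w. polylog 3 ((1 - w) / 2)) has_field_derivative - polylog 2 ((1 - w) / 2) * (1 / (1 - w)))
       (at w within quarter_disc)"
  proof (rule has_field_derivative_chain_within[OF has_field_derivative_polylog_3_left
        quarter_disc_images(2) deriv_b])
    show "Re ((1 - w) / 2) \<le> 1" using quarter_disc_images(2) w by blast
    have "1 - w \<noteq> 0" using w by simp
    then show "(if (1 - w) / 2 = 0 then 1 else polylog 2 ((1 - w) / 2) / ((1 - w) / 2)) * (- 1 / 2)
        = - polylog 2 ((1 - w) / 2) * (1 / (1 - w))"
      by (simp only: half_eq_0_iff if_False cancel(2))
  qed (fact w)
  show "((\<lambda>w. polylog 3 ((1 + 1/w) / 2)) has_field_derivative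
       - polylog 2 ((1 + 1/w) / 2) * (1 / w - 1 / (1 + w))) (at w within quarter_disc)"
  proof (rule has_field_derivative_chain_within[OF has_field_derivative_polylog_3_lower_half
        quarter_disc_images(4) deriv_c])
    show "(1 + 1/w) / 2 \<in> lower_half" using quarter_disc_images(4) w by blast
    show "(if (1 + 1/w) / 2 = 0 then 1 else polylog 2 ((1 + 1/w) / 2) / ((1 + 1/w) / 2)) * (- 1 / (2 * w\<^sup>2))
        = - polylog 2 ((1 + 1/w) / 2) * (1 / w - 1 / (1 + w))"
      using ne by (simp only: half_eq_0_iff if_False, subst cancel(3)) (simp only: partial_fractions[OF w] cancel(4))
  qed (fact w)
  show "((\<lambda>w. polylog 3 ((1 - 1/w) / 2)) has_field_derivative
       - polylog 2 ((1 - 1/w) / 2) * (1 / (1 - w) + 1 / w)) (at w within quarter_disc)"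
  proof (rule has_field_derivative_chain_within[OF has_field_derivative_polylog_3_left
        quarter_disc_images(3) deriv_d])
    show "Re ((1 - 1/w) / 2) \<le> 1" using quarter_disc_images(3) w by blast
    have "1 - 1 / w \<noteq> 0" using ne by simp
    then show "(if (1 - 1/w) / 2 = 0 then 1 else polylog 2 ((1 - 1/w) / 2) / ((1 - 1/w) / 2)) * (1 / (2 * w\<^sup>2))
        = - polylog 2 ((1 - 1/w) / 2) * (1 / (1 - w) + 1 / w)"
      by (simp only: half_eq_0_iff if_False, subst cancel(3)) (simp only: partial_fractions[OF w] cancel(4))
  qed (fact w)
qed

section \<open>Continuity on the quarter disc, including w = 1\<close>

lemma continuous_on_quarter_disc_arguments:
  "continuous_on quarter_disc (\<lambda>w. (1 + w) / 2)"
  "continuous_on quarter_disc (\<lambda>w. (1 - w) / 2)"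
  "continuous_on quarter_disc (\<lambda>w. (1 - 1 / w) / 2)"
  "continuous_on quarter_disc (\<lambda>w. (1 + 1 / w) / 2)"
  using quarter_disc_inverse(1) by (auto intro!: continuous_intros)

lemma continuous_on_polylog_3:
  "continuous_on {z. Re z \<le> 1} (polylog 3)" "continuous_on lower_half (polylog 3)"
  unfolding continuous_on_eq_continuous_within
  using has_field_derivative_polylog_3_left has_field_derivative_polylog_3_lower_half
  by (blast intro: DERIV_continuous)+

lemmas continuous_on_quarter_disc_polylog =
  continuous_on_compose2[OF continuous_on_polylog_2_left
    continuous_on_quarter_disc_arguments(1) quarter_disc_images(1)]
  continuous_on_compose2[OF continuous_on_polylog_2_left
    continuous_on_quarter_disc_arguments(2) quarter_disc_images(2)]
  continuous_on_compose2[OF continuous_on_polylog_2_left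
    continuous_on_quarter_disc_arguments(3) quarter_disc_images(3)]
  continuous_on_compose2[OF continuous_on_polylog_2_lower_half
    continuous_on_quarter_disc_arguments(4) quarter_disc_images(4)]
  continuous_on_compose2[OF continuous_on_polylog_3(1)
    continuous_on_quarter_disc_arguments(1) quarter_disc_images(1)]
  continuous_on_compose2[OF continuous_on_polylog_3(1)
    continuous_on_quarter_disc_arguments(2) quarter_disc_images(2)]
  continuous_on_compose2[OF continuous_on_polylog_3(1)
    continuous_on_quarter_disc_arguments(3) quarter_disc_images(3)]
  continuous_on_compose2[OF continuous_on_polylog_3(2)
    continuous_on_quarter_disc_arguments(4) quarter_disc_images(4)]

lemma continuous_on_quarter_disc_Ln:
  "continuous_on quarter_disc Ln"
  "continuous_on quarter_disc (\<lambda>w. Ln ((1 + w) / 2))"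
  unfolding continuous_on_eq_continuous_within
  using deriv_Ln deriv_Ln_a by (blast intro: DERIV_continuous)+

text \<open>At w = 1 the second factor diverges, so the product has to be treated as a
  whole.\<close>

lemma continuous_on_quarter_disc_Ln_mult_Ln:
  "continuous_on quarter_disc (\<lambda>w. Ln w * Ln ((1 - w) / 2))"
  unfolding continuous_on_eq_continuous_within
proof
  fix w assume w: "w \<in> quarter_disc"
  show "continuous (at w within quarter_disc) (\<lambda>w. Ln w * Ln ((1 - w) / 2))"
  proof (cases "w = 1")
    case True
    \<comment> \<open>The constant ln 2 comes from Ln ((1 - w)/2) = Ln (1 - w) - ln 2.\<close>
    have "((\<lambda>w::complex. Ln w * Ln (1 - w) - Ln w * of_real (ln 2)) \<longlongrightarrow> 0 - Ln 1 * of_real (ln 2)) (at 1)"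
      by (intro tendsto_intros tendsto_Ln_mult_Ln) auto
    then have "((\<lambda>w::complex. Ln w * Ln (1 - w) - Ln w * of_real (ln 2)) \<longlongrightarrow> 0) (at 1)"
      by simp
    then have "((\<lambda>w::complex. Ln w * Ln ((1 - w) / 2)) \<longlongrightarrow> 0) (at 1)"
    proof (rule Lim_transform_eventually)
      have "Ln w * Ln (1 - w) - Ln w * of_real (ln 2) = Ln w * Ln ((1 - w) / 2)" if "w \<noteq> 1" for w :: complex
        using Ln_divide_of_real[of 2 "1 - w"] that by (simp flip: right_diff_distrib)
      then show "\<forall>\<^sub>F w in at (1::complex). Ln w * Ln (1 - w) - Ln w * of_real (ln 2) = Ln w * Ln ((1 - w) / 2)"
        by (simp add: eventually_at_filter)
    qed
    then have "isCont (\<lambda>w. Ln w * Ln ((1 - w) / 2)) 1"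
      by (simp add: isCont_def)
    then show ?thesis
      using True continuous_at_imp_continuous_within by blast
  next
    case False
    show ?thesis
      by (rule DERIV_continuous[OF DERIV_mult[OF deriv_Ln[OF w] deriv_Ln_b[OF w False]]])
  qed
qed

section \<open>The dilogarithm identity and the closed forms in w\<close>

lemma has_field_derivative_zero_unique:
  fixes f :: "complex \<Rightarrow> complex"
  assumes "convex S" "finite K" "continuous_on S f" "c \<in> S" "x \<in> S"
    and "\<And>x. x \<in> S \<Longrightarrow> x \<notin> K \<Longrightarrow> (f has_field_derivative 0) (at x within S)"
  shows "f x = f c"
  by (rule has_derivative_zero_unique_strong_convex[OF assms(1-4) refl _ assms(5)])
     (use assms(6) in \<open>auto simp: has_field_derivative_def lambda_zero\<close>)

lemma one_in_quarter_disc: "1 \<in> quarter_disc"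
  by (simp add: quarter_disc_def)

text \<open>The arguments pair up as (1 + w)/2 + (1 - w)/2 = 1 and (1 + 1/w)/2 + (1 - 1/w)/2 = 1.
  The identity is the difference of Euler's reflection formula for the two pairs, with the
  logarithms of the second pair expressed through w.\<close>

lemma dilog_identity:
  assumes "w \<in> quarter_disc"
  shows "polylog 2 ((1 - 1/w) / 2) - polylog 2 ((1 - w) / 2) - polylog 2 ((1 + w) / 2) + polylog 2 ((1 + 1/w) / 2)
    = Ln w * Ln ((1 + w) / 2) + Ln w * Ln ((1 - w) / 2) - Ln w * Ln w
      - \<i> * of_real pi * (Ln ((1 + w) / 2) - Ln w)"
proof -
  let ?f = "\<lambda>w. (polylog 2 ((1 - 1/w) / 2) - polylog 2 ((1 - w) / 2) - polylog 2 ((1 + w) / 2) + polylog 2 ((1 + 1/w) / 2))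
    - (Ln w * Ln ((1 + w) / 2) + Ln w * Ln ((1 - w) / 2) - Ln w * Ln w
      - \<i> * of_real pi * (Ln ((1 + w) / 2) - Ln w))"
  have *: "?f w = ?f 1" if "w \<in> quarter_disc" for w
  proof (rule has_field_derivative_zero_unique[where f = ?f and K = "{1}", OF convex_quarter_disc])
    show "continuous_on quarter_disc ?f"
      by (intro continuous_on_add continuous_on_diff continuous_on_mult continuous_on_const
          continuous_on_quarter_disc_polylog continuous_on_quarter_disc_Ln
          continuous_on_quarter_disc_Ln_mult_Ln)
    fix w assume w: "w \<in> quarter_disc" "w \<notin> {1}"
    then have ne: "w \<noteq> 1" by simp
    note d = deriv_Ln[OF w(1)] deriv_Ln_a[OF w(1)] deriv_Ln_b[OF w(1) ne]
      deriv_polylog_2_a[OF w(1) ne] deriv_polylog_2_b[OF w(1) ne]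
      deriv_polylog_2_c[OF w(1) ne] deriv_polylog_2_d[OF w(1) ne]
    show "(?f has_field_derivative 0) (at w within quarter_disc)"
      by (rule DERIV_cong, (rule d DERIV_const DERIV_add DERIV_diff DERIV_mult)+) algebra
  qed (use that one_in_quarter_disc in auto)
  show ?thesis using *[OF assms] by simp
qed

text \<open>With x = (1 - w^2)/w, this is the sum of the series with (2n+1)^2 in place of (2n+1)^3, that is,
  the image under x d/dx of the claimed value, expressed through w.\<close>

definition dilog_comb :: "complex \<Rightarrow> complex" where
  "dilog_comb w = polylog 2 ((1 + 1/w) / 2) - polylog 2 ((1 + w) / 2)
     + polylog 2 ((1 - w) / 2) - polylog 2 ((1 - 1/w) / 2)
     + Ln w * Ln ((1 + w) / 2) - Ln w * Ln ((1 - w) / 2)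
     + \<i> * of_real pi * (Ln ((1 + w) / 2) - Ln w)"

text \<open>The claimed value, with log ((1 + 1/w)/2) already split as in
  \<open>Ln_half_one_plus_inverse\<close>, so that only logarithms with known derivatives
  occur.\<close>

definition trilog_comb :: "complex \<Rightarrow> complex" where
  "trilog_comb w = - 2 * (polylog 3 ((1 + w) / 2) - polylog 3 ((1 - w) / 2)
             - polylog 3 ((1 + 1/w) / 2) + polylog 3 ((1 - 1/w) / 2))
      + (polylog 2 ((1 + w) / 2) - polylog 2 ((1 - w) / 2)
         + polylog 2 ((1 + 1/w) / 2) - polylog 2 ((1 - 1/w) / 2)) * Ln w
      + of_real pi * \<i> * Ln ((1 + w) / 2) * (Ln ((1 + w) / 2) - Ln w)"

lemma continuous_on_combs:
  "continuous_on quarter_disc dilog_comb" "continuous_on quarter_disc trilog_comb"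
  unfolding dilog_comb_def[abs_def] trilog_comb_def[abs_def]
  by (intro continuous_on_add continuous_on_diff continuous_on_mult continuous_on_const
      continuous_on_quarter_disc_polylog continuous_on_quarter_disc_Ln
      continuous_on_quarter_disc_Ln_mult_Ln)+

text \<open>At w = 1 the arguments coincide in pairs, 1 with 1 and 0 with 0, so the polylogarithms
  cancel. This fixes both constants of integration.\<close>

lemma combs_at_1: "dilog_comb 1 = 0" "trilog_comb 1 = 0"
  by (simp_all add: dilog_comb_def trilog_comb_def)

lemma has_field_derivative_combs:
  assumes w: "w \<in> quarter_disc" and ne: "w \<noteq> 1"
  shows "(dilog_comb has_field_derivative 2 * Ln w * (1 / (1 + w) + 1 / (1 - w))) (at w within quarter_disc)"
    and "(trilog_comb has_field_derivative
            - (1 / w + 1 / (1 - w) - 1 / (1 + w)) * dilog_comb w) (at w within quarter_disc)"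
proof -
  note d = deriv_Ln[OF w] deriv_Ln_a[OF w] deriv_Ln_b[OF w ne]
    deriv_polylog_2_a[OF w ne] deriv_polylog_2_b[OF w ne]
    deriv_polylog_2_c[OF w ne] deriv_polylog_2_d[OF w ne] deriv_polylog_3[OF w ne]
  show "(dilog_comb has_field_derivative 2 * Ln w * (1 / (1 + w) + 1 / (1 - w))) (at w within quarter_disc)"
    unfolding dilog_comb_def[abs_def]
    by (rule DERIV_cong, (rule d DERIV_const DERIV_add DERIV_diff DERIV_mult)+) algebra
  \<comment> \<open>The coefficient of 1/w matches at once. Those of 1/(1 + w) and 1/(1 - w) contain
    only two of the four dilogarithms each, whereas \<open>dilog_comb\<close> contains all four;
    eliminating one of them makes these match too.\<close>
  have id: "polylog 2 ((1 - 1/w) / 2) = polylog 2 ((1 - w) / 2) + polylog 2 ((1 + w) / 2) - polylog 2 ((1 + 1/w) / 2)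
      + Ln w * Ln ((1 + w) / 2) + Ln w * Ln ((1 - w) / 2) - Ln w * Ln w
      - \<i> * of_real pi * (Ln ((1 + w) / 2) - Ln w)"
    using dilog_identity[OF w] by (simp add: algebra_simps)
  show "(trilog_comb has_field_derivative
            - (1 / w + 1 / (1 - w) - 1 / (1 + w)) * dilog_comb w) (at w within quarter_disc)"
    unfolding trilog_comb_def[abs_def]
    by (rule DERIV_cong, (rule d DERIV_const DERIV_add DERIV_diff DERIV_mult)+)
       (unfold dilog_comb_def id, algebra)
qed

subsection \<open>The central binomial series\<close>

text \<open>The factor 4^n comes from x = 2 y, since x^(2n+1) = 2 y (4 y^2)^n.\<close>

definition cb_coeff :: "nat \<Rightarrow> nat \<Rightarrow> complex" where
  "cb_coeff j n = (- 4) ^ n / (of_nat (2 * n + 1) ^ j * of_nat ((2 * n) choose n))"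

lemma cb_coeff_Suc: "of_nat (2 * n + 1) * cb_coeff (Suc j) n = cb_coeff j n"
  by (simp add: cb_coeff_def field_simps del: of_nat_Suc of_nat_add of_nat_mult)

lemma central_binomial_Suc:
  "Suc n * ((2 * Suc n) choose (Suc n)) = 2 * (2 * n + 1) * ((2 * n) choose n)"
proof -
  \<comment> \<open>The extra factor n + 1 allows the absorption identity to be applied twice
    without division.\<close>
  have "Suc n * (Suc n * ((2 * Suc n) choose Suc n)) = Suc n * (2 * (2 * n + 1) * ((2 * n) choose n))"
  proof -
    have 1: "Suc n * ((2 * Suc n) choose Suc n) = (2 * n + 2) * ((2 * n + 1) choose n)"
      using Suc_times_binomial_eq[of "2 * n + 1" n] by (simp add: mult.commute)
    have "((2 * n + 1) choose n) = ((2 * n + 1) choose Suc n)"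
      using binomial_symmetric[of n "2 * n + 1"] by simp
    then have 2: "Suc n * ((2 * n + 1) choose n) = (2 * n + 1) * ((2 * n) choose n)"
      using Suc_times_binomial_eq[of "2 * n" n] by (simp add: mult.commute)
    have "Suc n * (Suc n * ((2 * Suc n) choose Suc n)) = (2 * n + 2) * (Suc n * ((2 * n + 1) choose n))"
      unfolding 1 by (simp only: mult.left_commute)
    also have "\<dots> = Suc n * (2 * (2 * n + 1) * ((2 * n) choose n))"
      unfolding 2 by (simp add: algebra_simps)
    finally show ?thesis .
  qed
  then show ?thesis by (simp only: mult_cancel1) simp
qed

text \<open>By the ratio of consecutive central binomial coefficients,
  \<open>cb_coeff 0 (Suc n)\<close> is \<open>cb_coeff 0 n\<close> times - (2n+2)/(2n+1) = - 1 -
  1/(2n+1), and the last fraction turns exponent 0 into exponent 1.\<close>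

lemma cb_coeff_recurrence: "cb_coeff 0 (Suc n) + cb_coeff 0 n + cb_coeff 1 n = 0"
proof -
  define C D :: complex where "C = of_nat ((2 * n) choose n)" and "D = of_nat ((2 * Suc n) choose Suc n)"
  have nz: "C \<noteq> 0" "D \<noteq> 0" "of_nat n + 1 \<noteq> (0::complex)" "2 * of_nat n + 1 \<noteq> (0::complex)"
    by (simp_all add: C_def D_def del: mult_Suc_right mult_Suc binomial_Suc_Suc)
       (metis of_nat_Suc of_nat_eq_0_iff of_nat_mult of_nat_numeral nat.simps(3) add.commute)+
  have "(of_nat n + 1) * D = 2 * (2 * of_nat n + 1) * C"
    using arg_cong[OF central_binomial_Suc[of n], of "of_nat :: nat \<Rightarrow> complex"]
    by (simp add: C_def D_def algebra_simps del: mult_Suc_right mult_Suc binomial_Suc_Suc)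
  then have D: "D = 2 * (2 * of_nat n + 1) * C / (of_nat n + 1)"
    using nz by (simp add: field_simps)
  have cb_coeff: "cb_coeff 0 (Suc n) = - 4 * (- 4) ^ n / D" "cb_coeff 0 n = (- 4) ^ n / C"
    "cb_coeff 1 n = (- 4) ^ n / ((2 * of_nat n + 1) * C)"
    by (simp_all add: cb_coeff_def C_def D_def add.commute del: mult_Suc_right mult_Suc binomial_Suc_Suc)
  have "- 4 * p / (2 * k * C / l) + p / C + p / (k * C) = 0"
    if "k + 1 = 2 * l" "k \<noteq> 0" "l \<noteq> 0" for p k l
  proof -
    have "- 4 * p / (2 * k * C / l) + p / C + p / (k * C) = p * (k + 1 - 2 * l) / (k * C)"
      using that(2,3) nz(1) by (simp add: divide_simps) algebra
    then show ?thesis using that(1) by simp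
  qed
  from this[of "2 * of_nat n + 1" "of_nat n + 1" "(- 4) ^ n"]
  show ?thesis
    unfolding cb_coeff D using nz(3,4) by simp
qed

lemma norm_cb_coeff_0: "norm (cb_coeff 0 n) \<le> 2 * real n + 1"
proof (cases "n = 0")
  case False
  have "4 ^ n / (2 * real n) \<le> real ((2 * n) choose n)"
    using False by (intro central_binomial_lower_bound) simp
  then have "4 ^ n / real ((2 * n) choose n) \<le> 2 * real n"
    using False by (simp add: field_simps)
  then show ?thesis
    by (simp add: cb_coeff_def norm_divide norm_power)
qed (simp add: cb_coeff_def)

lemma norm_cb_coeff: "norm (cb_coeff j n) \<le> (2 * real n + 1) / (2 * real n + 1) ^ j"
proof -
  have "cb_coeff j n = cb_coeff 0 n / of_nat (2 * n + 1) ^ j"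
    by (simp add: cb_coeff_def)
  moreover have "norm (of_nat (2 * n + 1) :: complex) = 2 * real n + 1"
    unfolding norm_of_nat by simp
  ultimately have "norm (cb_coeff j n) = norm (cb_coeff 0 n) / (2 * real n + 1) ^ j"
    by (simp only: norm_divide norm_power)
  then show ?thesis
    using norm_cb_coeff_0[of n] by (simp add: divide_right_mono)
qed

lemma summable_cb_coeff:
  assumes "norm u < 1" shows "summable (\<lambda>n. cb_coeff j n * u ^ n)"
proof (rule summable_comparison_test)
  have "summable (\<lambda>n. of_nat (Suc n) * norm u ^ n)"
    using geometric_deriv_sums[of "norm u"] assms by (simp add: sums_iff)
  then show "summable (\<lambda>n. 2 * (of_nat (Suc n) * norm u ^ n))"
    by (rule summable_mult)
  have "norm (cb_coeff j n) \<le> 2 * real (Suc n)" for n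
  proof -
    have "(2 * real n + 1) / (2 * real n + 1) ^ j \<le> 2 * real n + 1"
      by (simp add: divide_le_eq one_le_power mult_le_cancel_left1)
    then show ?thesis using norm_cb_coeff[of j n] by simp
  qed
  then have "norm (cb_coeff j n * u ^ n) \<le> 2 * (of_nat (Suc n) * norm u ^ n)" for n
    using mult_right_mono[of "norm (cb_coeff j n)" "2 * real (Suc n)" "norm u ^ n"]
    by (simp add: norm_mult norm_power mult.assoc del: of_nat_Suc)
  then show "\<exists>N. \<forall>n\<ge>N. norm (cb_coeff j n * u ^ n) \<le> 2 * (of_nat (Suc n) * norm u ^ n)"
    by blast
qed

text \<open>The power series in u = y^2 behind the odd series \<open>cb_series\<close>, where y = (1/w - w)/2.\<close>

definition cb_power_series :: "nat \<Rightarrow> complex \<Rightarrow> complex" where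
  "cb_power_series j u = (\<Sum>n. cb_coeff j n * u ^ n)"

text \<open>The operator 1 + 2 u d/du multiplies u^n by 2n+1; it is y d/dy acting on y^(2n+1),
  rewritten in u = y^2.\<close>

lemma cb_power_series_deriv:
  assumes "norm u < 1"
  obtains D where "(cb_power_series (Suc j) has_field_derivative D) (at u)" "cb_power_series (Suc j) u + 2 * u * D = cb_power_series j u"
proof
  define K where "K = (norm u + 1) / 2"
  let ?D = "\<Sum>n. diffs (cb_coeff (Suc j)) n * u ^ n"
  have K: "norm u < norm (of_real K :: complex)" "norm (of_real K :: complex) < 1"
    using assms by (auto simp: K_def)
  show "(cb_power_series (Suc j) has_field_derivative ?D) (at u)"
    unfolding cb_power_series_def[abs_def] by (rule termdiffs_strong[OF summable_cb_coeff[OF K(2)] K(1)])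
  have "summable (\<lambda>n. diffs (cb_coeff (Suc j)) n * u ^ n)"
    by (rule termdiff_converges[OF assms]) (rule summable_cb_coeff)
  from diffs_equiv[OF this]
  have "(\<lambda>n. of_nat n * cb_coeff (Suc j) n * u ^ (n - Suc 0)) sums ?D" .
  from sums_add[OF summable_sums[OF summable_cb_coeff[OF assms]] sums_mult[OF this, of "2 * u"]]
  have "(\<lambda>n. cb_coeff (Suc j) n * u ^ n + 2 * u * (of_nat n * cb_coeff (Suc j) n * u ^ (n - Suc 0)))
      sums (cb_power_series (Suc j) u + 2 * u * ?D)"
    unfolding cb_power_series_def .
  moreover have "cb_coeff (Suc j) n * u ^ n + 2 * u * (of_nat n * cb_coeff (Suc j) n * u ^ (n - Suc 0)) = cb_coeff j n * u ^ n" for n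
    unfolding cb_coeff_Suc[of n j, symmetric] by (cases n) (simp_all add: algebra_simps)
  ultimately show "cb_power_series (Suc j) u + 2 * u * ?D = cb_power_series j u"
    by (simp add: cb_power_series_def sums_iff)
qed

text \<open>Summing the coefficient recurrence; the 1 is the initial coefficient missed by the
  shift. In terms of f = \<open>cb_series 1\<close> this is the differential equation (1 + y^2) f' +
  y f = 2.\<close>

lemma cb_power_series_recurrence:
  assumes "norm u < 1" shows "(1 + u) * cb_power_series 0 u + u * cb_power_series 1 u = 1"
proof -
  note s = summable_sums[OF summable_cb_coeff[OF assms], folded cb_power_series_def]
  have "(\<lambda>n. cb_coeff 0 (Suc n) * u ^ Suc n) sums (cb_power_series 0 u - cb_coeff 0 0)"
    using sums_split_initial_segment[OF s[of 0], of 1] by (simp del: power_Suc)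
  from sums_add[OF this sums_add[OF sums_mult[OF s[of 0], of u] sums_mult[OF s[of 1], of u]]]
  have "(\<lambda>n. u ^ Suc n * (cb_coeff 0 (Suc n) + cb_coeff 0 n + cb_coeff 1 n)) sums (cb_power_series 0 u - 1 + (u * cb_power_series 0 u + u * cb_power_series 1 u))"
    by (simp add: algebra_simps cb_coeff_def)
  then have "cb_power_series 0 u - 1 + (u * cb_power_series 0 u + u * cb_power_series 1 u) = 0"
    unfolding cb_coeff_recurrence using sums_unique2[OF _ sums_zero] by simp
  then show ?thesis by (simp add: algebra_simps)
qed

text \<open>The linear bound on 4^n over the central binomial coefficient uses up one of the three
  powers of 2n+1; the two left give absolute convergence on the closed disc.\<close>

lemma norm_cb_coeff_3: "norm (cb_coeff 3 n) \<le> inverse (real (n + 1) ^ 2)"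
proof -
  have "x / x ^ 3 = inverse (x ^ 2)" for x :: real
    by (cases "x = 0") (simp_all add: power2_eq_square power3_eq_cube field_simps)
  then have "(2 * real n + 1) / (2 * real n + 1) ^ 3 = inverse ((2 * real n + 1) ^ 2)"
    by blast
  also have "\<dots> \<le> inverse (real (n + 1) ^ 2)"
    by (intro le_imp_inverse_le power_mono) auto
  finally show ?thesis using norm_cb_coeff[of 3 n] by simp
qed

lemma cb_coeff_3_bound:
  assumes "norm u \<le> 1" shows "norm (cb_coeff 3 n * u ^ n) \<le> inverse (real (n + 1) ^ 2)"
proof -
  have "norm (cb_coeff 3 n * u ^ n) \<le> norm (cb_coeff 3 n) * 1"
    unfolding norm_mult norm_power using assms by (intro mult_left_mono power_le_one) auto
  then show ?thesis using norm_cb_coeff_3[of n] by simp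
qed

lemma summable_inverse_squares: "summable (\<lambda>n. inverse (real (n + 1) ^ 2))"
  by (rule summable_ignore_initial_segment[OF inverse_power_summable]) simp

lemma continuous_on_cb_power_series_3: "continuous_on (cball 0 1) (cb_power_series 3)"
proof (rule uniform_limit_theorem)
  show "uniform_limit (cball 0 1) (\<lambda>n u. \<Sum>i<n. cb_coeff 3 i * u ^ i) (cb_power_series 3) sequentially"
    unfolding cb_power_series_def[abs_def]
    by (rule Weierstrass_m_test[OF _ summable_inverse_squares]) (use cb_coeff_3_bound in simp)
qed (auto intro!: always_eventually continuous_intros)

definition cb_series :: "nat \<Rightarrow> complex \<Rightarrow> complex" where
  "cb_series j y = 2 * y * cb_power_series j (y\<^sup>2)"

lemma cb_series_0 [simp]: "cb_series j 0 = 0"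
  by (simp add: cb_series_def)

text \<open>Stated through \<open>cb_power_series\<close> instead of a quotient by y, so that it
  also holds at y = 0.\<close>

lemma cb_series_deriv:
  assumes "norm y < 1"
  shows "(cb_series (Suc j) has_field_derivative 2 * cb_power_series j (y\<^sup>2)) (at y)"
proof -
  have "norm (y\<^sup>2) < 1"
    using assms by (simp add: norm_power power_less_one_iff)
  then obtain D where D: "(cb_power_series (Suc j) has_field_derivative D) (at (y\<^sup>2))"
     "cb_power_series (Suc j) (y\<^sup>2) + 2 * y\<^sup>2 * D = cb_power_series j (y\<^sup>2)"
    using cb_power_series_deriv by blast
  have "((\<lambda>y. y\<^sup>2) has_field_derivative 2 * y) (at y)"
    by (auto intro!: derivative_eq_intros)
  from DERIV_chain2[OF D(1) this]
  have "((\<lambda>y. 2 * y * cb_power_series (Suc j) (y\<^sup>2)) has_field_derivative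
      2 * cb_power_series (Suc j) (y\<^sup>2) + D * (2 * y) * (2 * y)) (at y)"
    by (auto intro!: derivative_eq_intros)
  moreover have "2 * cb_power_series (Suc j) (y\<^sup>2) + D * (2 * y) * (2 * y) = 2 * cb_power_series j (y\<^sup>2)"
    unfolding D(2)[symmetric] by (simp add: algebra_simps power2_eq_square)
  ultimately show ?thesis
    unfolding cb_series_def[abs_def] by simp
qed

lemma cb_series_sums:
  assumes "norm y \<le> 1"
  shows "(\<lambda>n. (-1) ^ n / (of_nat (2*n+1) ^ 3 * of_nat ((2*n) choose n)) * (2 * y) ^ (2*n+1)) sums cb_series 3 y"
proof -
  have "norm (y\<^sup>2) \<le> 1"
    using assms by (simp add: norm_power power_le_one)
  then have "summable (\<lambda>n. cb_coeff 3 n * (y\<^sup>2) ^ n)"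
    by (intro summable_comparison_test'[OF summable_inverse_squares]) (rule cb_coeff_3_bound)
  then have "(\<lambda>n. 2 * y * (cb_coeff 3 n * (y\<^sup>2) ^ n)) sums cb_series 3 y"
    unfolding cb_series_def cb_power_series_def by (intro sums_mult summable_sums)
  moreover have "2 * y * (cb_coeff 3 n * (y\<^sup>2) ^ n) =
     (-1) ^ n / (of_nat (2*n+1) ^ 3 * of_nat ((2*n) choose n)) * (2 * y) ^ (2*n+1)" for n
  proof -
    have "(- 4 :: complex) ^ n = (-1) ^ n * (2 ^ n) ^ 2"
      by (simp add: power_mult[symmetric] mult.commute[of n] power_mult power_mult_distrib[symmetric])
    then show ?thesis
      by (simp add: cb_coeff_def power_mult_distrib power_add power_mult [symmetric] mult.commute[of n 2] power2_eq_square
          power_even_eq)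
  qed
  ultimately show ?thesis by simp
qed

subsection \<open>Uniformization\<close>

text \<open>The removed point - i is where 1 + y^2 vanishes; it corresponds to w = i, which Re w > 0
  excludes.\<close>

definition closed_lower_quarter :: "complex set"
  where "closed_lower_quarter = {y. Re y \<ge> 0 \<and> Im y \<le> 0 \<and> norm y \<le> 1 \<and> y \<noteq> - \<i>}"

text \<open>The branch of the inverse of w \<open>\<mapsto>\<close> (1/w - w)/2 with value 1 at 0.\<close>

definition joukowski_inv :: "complex \<Rightarrow> complex"
  where "joukowski_inv y = csqrt (1 + y\<^sup>2) - y"

text \<open>For |y| <= 1 the real part of 1 + y^2 is nonpositive only at y = i and y = - i.\<close>

lemma one_plus_square_notin_nonpos_Reals:
  assumes "y \<in> closed_lower_quarter" shows "1 + y\<^sup>2 \<notin> \<real>\<^sub>\<le>\<^sub>0"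
proof
  assume "1 + y\<^sup>2 \<in> \<real>\<^sub>\<le>\<^sub>0"
  then have 1: "1 + (Re y)\<^sup>2 - (Im y)\<^sup>2 \<le> 0"
    by (simp add: complex_nonpos_Reals_iff power2_eq_square)
  have "(norm y)\<^sup>2 \<le> 1"
    using assms by (simp add: closed_lower_quarter_def power_le_one)
  then have 2: "(Re y)\<^sup>2 + (Im y)\<^sup>2 \<le> 1"
    by (simp add: cmod_power2)
  have "(Re y)\<^sup>2 = 0" using 1 2 zero_le_power2[of "Re y"] by linarith
  moreover from this have "(Im y)\<^sup>2 = 1" using 1 2 by linarith
  ultimately have "y = - \<i>"
    using assms by (auto simp: closed_lower_quarter_def complex_eq_iff power2_eq_1_iff)
  then show False using assms by (simp add: closed_lower_quarter_def)
qed

lemma Re_csqrt_pos: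
  assumes "z \<notin> \<real>\<^sub>\<le>\<^sub>0" shows "Re (csqrt z) > 0"
proof (rule ccontr)
  assume "\<not> Re (csqrt z) > 0"
  then have "Re (csqrt z) = 0" using csqrt_principal[of z] by linarith
  then have "Im ((csqrt z)\<^sup>2) = 0" "Re ((csqrt z)\<^sup>2) \<le> 0"
    by (simp_all add: power2_eq_square)
  then show False using assms by (simp add: complex_nonpos_Reals_iff)
qed

lemma joukowski_inv_mult: "joukowski_inv y * (csqrt (1 + y\<^sup>2) + y) = 1"
proof -
  have "joukowski_inv y * (csqrt (1 + y\<^sup>2) + y) = (csqrt (1 + y\<^sup>2))\<^sup>2 - y\<^sup>2"
    by (simp add: joukowski_inv_def algebra_simps power2_eq_square)
  then show ?thesis by simp
qed

lemma joukowski_inv_nonzero: "joukowski_inv y \<noteq> 0"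
  using joukowski_inv_mult[of y] by auto

lemma inverse_joukowski_inv: "1 / joukowski_inv y = csqrt (1 + y\<^sup>2) + y"
  using joukowski_inv_mult[of y] joukowski_inv_nonzero[of y] by (simp add: field_simps)

lemma joukowski_inv_eq_1_iff: "joukowski_inv y = 1 \<longleftrightarrow> y = 0"
proof
  assume "joukowski_inv y = 1"
  then have "csqrt (1 + y\<^sup>2) + y = csqrt (1 + y\<^sup>2) - y"
    using inverse_joukowski_inv[of y] joukowski_inv_def[of y] by simp
  then show "y = 0" by simp
qed (simp add: joukowski_inv_def)

text \<open>With v = 1/w and N = |v|^2, taking real and imaginary parts of v - 1/v = 2 y gives Re v
  (1 - 1/N) >= 0 and Im v (1 + 1/N) <= 0. Since Re v > 0, the former yields |w| <= 1 and the latter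
  Im w >= 0.\<close>

lemma joukowski_inv_in_quarter_disc:
  assumes y: "y \<in> closed_lower_quarter" shows "joukowski_inv y \<in> quarter_disc"
proof -
  define v where "v = csqrt (1 + y\<^sup>2) + y"
  have w: "joukowski_inv y = inverse v"
    using inverse_joukowski_inv[of y] unfolding v_def by (metis inverse_eq_divide inverse_inverse_eq)
  define N where "N = (Re v)\<^sup>2 + (Im v)\<^sup>2"
  have Rev: "Re v > 0"
    using Re_csqrt_pos[OF one_plus_square_notin_nonpos_Reals[OF y]] y
    by (simp add: v_def closed_lower_quarter_def add_pos_nonneg del: csqrt.simps)
  then have N: "N > 0" by (simp add: N_def sum_power2_gt_zero_iff)
  have sel: "Re (joukowski_inv y) = Re v / N" "Im (joukowski_inv y) = - Im v / N"
    by (simp_all add: w N_def)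
  have "v - joukowski_inv y = 2 * y"
    by (simp add: joukowski_inv_def v_def)
  then have "Re v - Re v / N = 2 * Re y" "Im v + Im v / N = 2 * Im y"
    using arg_cong[of "v - joukowski_inv y" "2 * y" Re] arg_cong[of "v - joukowski_inv y" "2 * y" Im]
    unfolding minus_complex.sel sel by simp_all
  then have re: "Re v - Re v / N \<ge> 0" and im: "Im v + Im v / N \<le> 0"
    using y by (simp_all add: closed_lower_quarter_def)
  have "Re v \<le> Re v * N"
    using re N by (simp add: field_simps)
  then have "1 \<le> N" using Rev by simp
  then have "norm v \<ge> 1"
    by (simp add: N_def cmod_def)
  then have 1: "norm (joukowski_inv y) \<le> 1"
    by (simp add: w norm_inverse inverse_le_1_iff)
  have "Im v \<le> 0"
  proof (rule ccontr)
    assume "\<not> Im v \<le> 0"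
    then have "Im v > 0" "Im v / N > 0" using N by auto
    then show False using im by linarith
  qed
  then have "Im (joukowski_inv y) \<ge> 0"
    using N by (simp add: sel divide_nonpos_pos)
  with 1 Rev N show ?thesis
    by (simp add: quarter_disc_def sel)
qed

lemma joukowski_inv_deriv:
  assumes "y \<in> closed_lower_quarter"
  shows "(joukowski_inv has_field_derivative - joukowski_inv y / csqrt (1 + y\<^sup>2)) (at y within A)"
proof -
  have nz: "csqrt (1 + y\<^sup>2) \<noteq> 0"
    using one_plus_square_notin_nonpos_Reals[OF assms] by auto
  have "((\<lambda>y. 1 + y\<^sup>2) has_field_derivative 2 * y) (at y within A)"
    by (auto intro!: derivative_eq_intros)
  from has_field_derivative_csqrt'[OF this one_plus_square_notin_nonpos_Reals[OF assms]]
  have "(joukowski_inv has_field_derivative 2 * y / (2 * csqrt (1 + y\<^sup>2)) - 1) (at y within A)"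
    unfolding joukowski_inv_def[abs_def] by (rule DERIV_diff[OF _ DERIV_ident])
  then show ?thesis
    by (rule DERIV_cong) (use nz in \<open>simp add: joukowski_inv_def divide_simps\<close>)
qed

text \<open>Open only along the arc: the straight edges belong to it, since real w gives real y. Off
  the arc the power series can be differentiated.\<close>

definition open_lower_quarter :: "complex set"
  where "open_lower_quarter = {y. Re y \<ge> 0 \<and> Im y \<le> 0 \<and> norm y < 1}"

lemma open_lower_quarter_subset: "open_lower_quarter \<subseteq> closed_lower_quarter"
  by (auto simp: open_lower_quarter_def closed_lower_quarter_def)

lemma convex_open_lower_quarter: "convex open_lower_quarter"
proof -
  have *: "open_lower_quarter = {y. Re y \<ge> 0} \<inter> {y. Im y \<le> 0} \<inter> ball 0 1"
    by (auto simp: open_lower_quarter_def)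
  show ?thesis
    unfolding * by (intro convex_Int convex_halfspace_Re_ge convex_halfspace_Im_le convex_ball)
qed

lemma zero_in_open_lower_quarter: "0 \<in> open_lower_quarter"
  by (simp add: open_lower_quarter_def)

lemma continuous_on_joukowski_inv: "continuous_on closed_lower_quarter joukowski_inv"
  unfolding continuous_on_eq_continuous_within by (meson joukowski_inv_deriv DERIV_continuous)

text \<open>This is the expansion of 2 arsinh y / sqrt (1 + y^2), since Ln (joukowski_inv y) = - arsinh y.\<close>

lemma cb_series_1:
  assumes "y \<in> open_lower_quarter"
  shows "csqrt (1 + y\<^sup>2) * cb_series 1 y = - 2 * Ln (joukowski_inv y)"
proof -
  let ?f = "\<lambda>y. csqrt (1 + y\<^sup>2) * cb_series 1 y + 2 * Ln (joukowski_inv y)"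
  have D: "(?f has_field_derivative 0) (at y within open_lower_quarter)" if y: "y \<in> open_lower_quarter" for y
  proof -
    define s where "s = csqrt (1 + y\<^sup>2)"
    have y': "y \<in> closed_lower_quarter" and norm: "norm y < 1" "norm (y\<^sup>2) < 1"
      using y open_lower_quarter_subset by (auto simp: open_lower_quarter_def norm_power power_less_one_iff)
    have s2: "s\<^sup>2 = 1 + y\<^sup>2"
      by (simp add: s_def)
    have nz: "s \<noteq> 0"
      using one_plus_square_notin_nonpos_Reals[OF y'] by (auto simp: s_def)
    have 1: "((\<lambda>y. csqrt (1 + y\<^sup>2)) has_field_derivative y / s) (at y within open_lower_quarter)"
      using one_plus_square_notin_nonpos_Reals[OF y']
      by (auto intro!: derivative_eq_intros simp: s_def)
    have 2: "((\<lambda>y. Ln (joukowski_inv y)) has_field_derivative - 1 / s) (at y within open_lower_quarter)"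
    proof (rule has_field_derivative_chain_within[OF deriv_Ln[OF joukowski_inv_in_quarter_disc[OF y']] _ joukowski_inv_deriv[OF y']])
      show "1 / joukowski_inv y * (- joukowski_inv y / csqrt (1 + y\<^sup>2)) = - 1 / s"
        using joukowski_inv_nonzero[of y] by (simp add: s_def)
    qed auto
    have 3: "(cb_series 1 has_field_derivative 2 * cb_power_series 0 (y\<^sup>2)) (at y within open_lower_quarter)"
      using has_field_derivative_at_within[OF cb_series_deriv[OF norm(1), of 0]] by simp
    \<comment> \<open>After s^2 = 1 + y^2 the numerator is twice the difference of the two sides of
      \<open>cb_power_series_recurrence\<close>.\<close>
    have "y / s * cb_series 1 y + 2 * cb_power_series 0 (y\<^sup>2) * s + 2 * (- 1 / s) = (y * cb_series 1 y + 2 * (s\<^sup>2 * cb_power_series 0 (y\<^sup>2)) - 2) / s"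
      using nz by (simp add: field_simps power2_eq_square)
    also have "y * cb_series 1 y + 2 * (s\<^sup>2 * cb_power_series 0 (y\<^sup>2)) - 2 = 2 * ((1 + y\<^sup>2) * cb_power_series 0 (y\<^sup>2) + y\<^sup>2 * cb_power_series 1 (y\<^sup>2)) - 2"
      unfolding s2 by (simp add: cb_series_def algebra_simps power2_eq_square)
    also have "\<dots> = 0"
      unfolding cb_power_series_recurrence[OF norm(2)] by simp
    finally have eq: "y / s * cb_series 1 y + 2 * cb_power_series 0 (y\<^sup>2) * s + 2 * (- 1 / s) = 0" by simp
    show ?thesis
      using DERIV_add[OF DERIV_mult[OF 1 3] DERIV_cmult[OF 2, of 2]]
      unfolding s_def[symmetric] eq .
  qed
  have "?f y = ?f 0"
  proof (rule has_field_derivative_zero_unique[where f = ?f and K = "{}", OF convex_open_lower_quarter])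
    show "continuous_on open_lower_quarter ?f"
      unfolding continuous_on_eq_continuous_within using D DERIV_continuous by blast
  qed (use assms D zero_in_open_lower_quarter in auto)
  then have "csqrt (1 + y\<^sup>2) * cb_series 1 y + 2 * Ln (joukowski_inv y) = 0"
    by (simp add: joukowski_inv_def)
  then show ?thesis by (simp add: add_eq_0_iff2)
qed

section \<open>Identification of the series with exponents 2 and 3 for |y| < 1\<close>

lemma continuous_on_cb_series: "continuous_on open_lower_quarter (cb_series (Suc j))"
proof (rule continuous_at_imp_continuous_on, safe)
  fix y assume "y \<in> open_lower_quarter"
  then show "isCont (cb_series (Suc j)) y"
    using DERIV_isCont[OF cb_series_deriv] by (simp add: open_lower_quarter_def)
qed

lemma continuous_on_comp_joukowski_inv:
  assumes "continuous_on quarter_disc f" "A \<subseteq> closed_lower_quarter"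
  shows "continuous_on A (\<lambda>y. f (joukowski_inv y))"
  by (rule continuous_on_compose2[OF assms(1) continuous_on_subset[OF continuous_on_joukowski_inv assms(2)]])
     (use assms(2) joukowski_inv_in_quarter_disc in auto)

text \<open>With s = (1/w + w)/2 one has dw/dy = - w/s. As y = (1 - w^2)/(2 w), the first equation
  rests on 2/(1 - w^2) = 1/(y w), and the second is the logarithmic derivative of y with respect to
  w, multiplied by dw/dy.\<close>

lemma joukowski_inv_field_facts:
  assumes "y \<in> closed_lower_quarter" "y \<noteq> 0"
  shows "(1 / (1 + joukowski_inv y) + 1 / (1 - joukowski_inv y)) * (- joukowski_inv y / csqrt (1 + y\<^sup>2)) = - 1 / (y * csqrt (1 + y\<^sup>2))"
    and "- (1 / joukowski_inv y + 1 / (1 - joukowski_inv y) - 1 / (1 + joukowski_inv y)) * (- joukowski_inv y / csqrt (1 + y\<^sup>2)) = 1 / y"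
proof -
  define w s where "w = joukowski_inv y" and "s = csqrt (1 + y\<^sup>2)"
  have w: "w \<in> quarter_disc" "w \<noteq> 1"
    using joukowski_inv_in_quarter_disc[OF assms(1)] joukowski_inv_eq_1_iff assms(2) by (auto simp: w_def)
  have nz: "w \<noteq> 0" "1 + w \<noteq> 0" "1 - w \<noteq> 0" "s \<noteq> 0"
    using quarter_disc_nonzero[OF w(1)] w one_plus_square_notin_nonpos_Reals[OF assms(1)] by (auto simp: s_def)
  have "1 / w = s + y" "w = s - y"
    unfolding w_def s_def by (rule inverse_joukowski_inv, rule joukowski_inv_def)
  then have "1 / w - w = 2 * y" "1 / w + w = 2 * s"
    by simp_all
  then have yw: "1 - w\<^sup>2 = 2 * y * w" and sw: "1 + w\<^sup>2 = 2 * s * w"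
    using nz by (simp_all add: field_simps power2_eq_square)
  have fac: "(1 + w) * (1 - w) = 2 * y * w"
    unfolding yw[symmetric] by (simp add: algebra_simps power2_eq_square)
  have "1 / (1 + w) + 1 / (1 - w) = 2 / ((1 + w) * (1 - w))"
    using nz by (simp add: divide_simps)
  also have "\<dots> = 1 / (y * w)" unfolding fac by simp
  finally show "(1 / (1 + joukowski_inv y) + 1 / (1 - joukowski_inv y)) * (- joukowski_inv y / csqrt (1 + y\<^sup>2)) = - 1 / (y * csqrt (1 + y\<^sup>2))"
    unfolding w_def[symmetric] s_def[symmetric] using nz assms(2) by simp
  have "1 / w + 1 / (1 - w) - 1 / (1 + w) = (1 + w\<^sup>2) / (w * ((1 + w) * (1 - w)))"
    using nz by (simp add: divide_simps) algebra
  also have "\<dots> = s / (w * y)"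
    unfolding fac sw using nz assms(2) by (simp add: divide_simps)
  finally show "- (1 / joukowski_inv y + 1 / (1 - joukowski_inv y) - 1 / (1 + joukowski_inv y)) * (- joukowski_inv y / csqrt (1 + y\<^sup>2)) = 1 / y"
    unfolding w_def[symmetric] s_def[symmetric] using nz assms(2) by simp
qed

lemma cb_series_deriv':
  assumes "y \<in> open_lower_quarter" "y \<noteq> 0"
  shows "(cb_series (Suc (Suc j)) has_field_derivative cb_series (Suc j) y / y) (at y within A)"
  using has_field_derivative_at_within[OF cb_series_deriv[of y "Suc j"]] assms
  by (simp add: cb_series_def open_lower_quarter_def)

lemma cb_series_2:
  assumes "y \<in> open_lower_quarter" shows "cb_series 2 y = dilog_comb (joukowski_inv y)"
proof -
  let ?f = "\<lambda>y. cb_series 2 y - dilog_comb (joukowski_inv y)"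
  have "?f y = ?f 0"
  \<comment> \<open>The exceptional point y = 0 corresponds to w = 1, where log ((1 - w)/2)
    diverges.\<close>
  proof (rule has_field_derivative_zero_unique[where f = ?f and K = "{0}", OF convex_open_lower_quarter])
    show "continuous_on open_lower_quarter ?f"
      using continuous_on_cb_series[of 1] continuous_on_comp_joukowski_inv[OF continuous_on_combs(1) open_lower_quarter_subset]
      by (auto intro!: continuous_intros simp: numeral_2_eq_2)
    fix y assume y: "y \<in> open_lower_quarter" "y \<notin> {0}"
    then have y': "y \<in> closed_lower_quarter" "y \<noteq> 0" using open_lower_quarter_subset by auto
    have nz: "csqrt (1 + y\<^sup>2) \<noteq> 0"
      using one_plus_square_notin_nonpos_Reals[OF y'(1)] by auto
    have "((\<lambda>y. dilog_comb (joukowski_inv y)) has_field_derivative cb_series 1 y / y) (at y within open_lower_quarter)"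
    proof (rule has_field_derivative_chain_within[OF has_field_derivative_combs(1) _ joukowski_inv_deriv[OF y'(1)]])
      have "2 * Ln (joukowski_inv y) * (1 / (1 + joukowski_inv y) + 1 / (1 - joukowski_inv y)) * (- joukowski_inv y / csqrt (1 + y\<^sup>2))
        = 2 * Ln (joukowski_inv y) * (- 1 / (y * csqrt (1 + y\<^sup>2)))"
        unfolding joukowski_inv_field_facts(1)[OF y', symmetric] by (simp only: mult.assoc)
      also have "\<dots> = (- 2 * Ln (joukowski_inv y)) / csqrt (1 + y\<^sup>2) / y"
        by simp
      also have "\<dots> = cb_series 1 y / y"
        unfolding cb_series_1[OF y(1), symmetric] using nz by simp
      finally show "2 * Ln (joukowski_inv y) * (1 / (1 + joukowski_inv y) + 1 / (1 - joukowski_inv y)) * (- joukowski_inv y / csqrt (1 + y\<^sup>2)) = cb_series 1 y / y" .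
    qed (use y' joukowski_inv_in_quarter_disc joukowski_inv_eq_1_iff open_lower_quarter_subset in auto)
    from DERIV_diff[OF cb_series_deriv'[OF y(1) y'(2), of 0] this]
    show "(?f has_field_derivative 0) (at y within open_lower_quarter)"
      by (simp add: numeral_2_eq_2)
  qed (use assms zero_in_open_lower_quarter in auto)
  then show ?thesis by (simp add: joukowski_inv_def combs_at_1)
qed

lemma cb_series_3:
  assumes "y \<in> open_lower_quarter" shows "cb_series 3 y = trilog_comb (joukowski_inv y)"
proof -
  let ?f = "\<lambda>y. cb_series 3 y - trilog_comb (joukowski_inv y)"
  have "?f y = ?f 0"
  proof (rule has_field_derivative_zero_unique[where f = ?f and K = "{0}", OF convex_open_lower_quarter])
    show "continuous_on open_lower_quarter ?f"
      using continuous_on_cb_series[of 2] continuous_on_comp_joukowski_inv[OF continuous_on_combs(2) open_lower_quarter_subset]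
      by (auto intro!: continuous_intros simp: numeral_3_eq_3 numeral_2_eq_2)
    fix y assume y: "y \<in> open_lower_quarter" "y \<notin> {0}"
    then have y': "y \<in> closed_lower_quarter" "y \<noteq> 0" using open_lower_quarter_subset by auto
    have "((\<lambda>y. trilog_comb (joukowski_inv y)) has_field_derivative cb_series 2 y / y) (at y within open_lower_quarter)"
    proof (rule has_field_derivative_chain_within[OF has_field_derivative_combs(2) _ joukowski_inv_deriv[OF y'(1)]])
      have "- (1 / joukowski_inv y + 1 / (1 - joukowski_inv y) - 1 / (1 + joukowski_inv y)) * dilog_comb (joukowski_inv y) * (- joukowski_inv y / csqrt (1 + y\<^sup>2))
        = 1 / y * dilog_comb (joukowski_inv y)"
        unfolding joukowski_inv_field_facts(2)[OF y', symmetric] by (simp only: mult_ac)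
      then show "- (1 / joukowski_inv y + 1 / (1 - joukowski_inv y) - 1 / (1 + joukowski_inv y)) * dilog_comb (joukowski_inv y) * (- joukowski_inv y / csqrt (1 + y\<^sup>2))
        = cb_series 2 y / y"
        unfolding cb_series_2[OF y(1)] by simp
    qed (use y' joukowski_inv_in_quarter_disc joukowski_inv_eq_1_iff open_lower_quarter_subset in auto)
    from DERIV_diff[OF cb_series_deriv'[OF y(1) y'(2), of 1] this]
    show "(?f has_field_derivative 0) (at y within open_lower_quarter)"
      by (simp add: numeral_3_eq_3 numeral_2_eq_2)
  qed (use assms zero_in_open_lower_quarter in auto)
  then show ?thesis by (simp add: joukowski_inv_def combs_at_1)
qed

section \<open>The boundary |y| = 1 and the conclusion\<close>

lemma cb_series_3_closed:
  assumes y: "y \<in> closed_lower_quarter" shows "cb_series 3 y = trilog_comb (joukowski_inv y)"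
proof -
  \<comment> \<open>The point y is approached along its radius, which stays in the closed quarter
    and avoids - i.\<close>
  let ?f = "\<lambda>t::real. cb_series 3 (of_real t * y) - trilog_comb (joukowski_inv (of_real t * y))"
  have norm: "norm y \<le> 1" using y by (simp add: closed_lower_quarter_def)
  have scale: "of_real t * y \<in> closed_lower_quarter" if "t \<in> {0..1}" for t
  proof (cases "t = 1")
    case False
    then have "norm (of_real t * y) < 1"
      using that norm mult_left_le[of "norm y" t] by (auto simp: norm_mult)
    then show ?thesis
      using that y by (auto simp: closed_lower_quarter_def mult_nonneg_nonpos)
  qed (use y in simp)
  have "?f 1 = 0"
  proof (rule continuous_constant_on_closure[where f = ?f and S = "{0..<1}"])
    have "continuous_on {0..1} (\<lambda>t::real. cb_power_series 3 ((of_real t * y)\<^sup>2))"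
    proof (rule continuous_on_compose2[OF continuous_on_cb_power_series_3])
      show "(\<lambda>t::real. (of_real t * y)\<^sup>2) ` {0..1} \<subseteq> cball 0 1"
        using scale by (auto simp: closed_lower_quarter_def norm_power power_le_one)
    qed (intro continuous_intros)
    then have "continuous_on {0..1} (\<lambda>t::real. cb_series 3 (of_real t * y))"
      unfolding cb_series_def by (intro continuous_intros)
    moreover have "continuous_on {0..1} (\<lambda>t::real. trilog_comb (joukowski_inv (of_real t * y)))"
      by (rule continuous_on_compose2[OF continuous_on_comp_joukowski_inv[OF continuous_on_combs(2) subset_refl]])
         (use scale in \<open>auto intro!: continuous_intros\<close>)
    ultimately show "continuous_on (closure {0..<1}) ?f"
      by (simp add: continuous_on_diff)
    fix t :: real assume t: "t \<in> {0..<1}"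
    then have "norm (of_real t * y) < 1"
      using norm mult_left_le[of "norm y" t] by (auto simp: norm_mult)
    then have "of_real t * y \<in> open_lower_quarter"
      using t scale[of t] by (auto simp: open_lower_quarter_def closed_lower_quarter_def)
    then show "?f t = 0" by (simp add: cb_series_3)
  qed simp
  then show ?thesis by simp
qed

text \<open>The square of (1/w + w)/2 is 1 + y^2, and its positive real part identifies it as the
  principal root.\<close>

lemma joukowski_inv_half_difference:
  assumes "w \<in> quarter_disc" shows "joukowski_inv ((1 / w - w) / 2) = w"
proof -
  have "((1 / w + w) / 2)\<^sup>2 = 1 + ((1 / w - w) / 2)\<^sup>2"
    using quarter_disc_inverse(1)[OF assms] by (simp add: field_simps power2_eq_square)
  moreover have "Re ((1 / w + w) / 2) > 0"
    using assms quarter_disc_inverse(2)[OF assms] by (simp add: quarter_disc_def)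
  ultimately have "csqrt (1 + ((1 / w - w) / 2)\<^sup>2) = (1 / w + w) / 2"
    by (intro csqrt_unique) auto
  then show ?thesis
    unfolding joukowski_inv_def by (simp add: field_simps)
qed

lemma half_difference_in_closed_lower_quarter:
  assumes w: "w \<in> quarter_disc" and le: "norm (1 - w\<^sup>2) \<le> 2 * norm w"
  shows "(1 / w - w) / 2 \<in> closed_lower_quarter"
proof -
  have w0: "w \<noteq> 0" "Re w > 0" "Im w \<ge> 0" "norm w \<le> 1"
    using w quarter_disc_inverse by (auto simp: quarter_disc_def)
  define N where "N = (norm w)\<^sup>2"
  have N: "0 < N" "N \<le> 1" using w0 by (auto simp: N_def power_le_one)
  have sel: "Re (1 / w) = Re w / N" "Im (1 / w) = - Im w / N"
    by (simp_all add: N_def Re_divide' Im_divide')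
  have "Re w \<le> Re w / N"
    using N w0 by (simp add: le_divide_eq mult_left_le)
  then have re: "Re ((1 / w - w) / 2) \<ge> 0"
    using sel by simp
  have "- Im w / N \<le> 0" using N w0 by simp
  then have im: "Im ((1 / w - w) / 2) \<le> 0"
    using sel w0 by simp
  have eq: "(1 / w - w) / 2 = (1 - w\<^sup>2) / (2 * w)"
    using w0 by (simp add: field_simps power2_eq_square)
  have norm: "norm ((1 / w - w) / 2) \<le> 1"
    unfolding eq using le w0 by (simp add: norm_divide norm_mult divide_le_eq)
  have "(1 / w - w) / 2 \<noteq> - \<i>"
  proof
    assume "(1 / w - w) / 2 = - \<i>"
    then have "1 - w\<^sup>2 = - 2 * \<i> * w"
      unfolding eq using w0 by (simp add: field_simps)
    \<comment> \<open>The value - i is attained with a double root, at w = i only.\<close>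
    then have "(w - \<i>)\<^sup>2 = 0"
      by (simp add: power2_eq_square algebra_simps)
    then have "w = \<i>" by simp
    then show False using w0 by simp
  qed
  with re im norm show ?thesis by (simp add: closed_lower_quarter_def)
qed

theorem theorem3:
  fixes w :: complex
  assumes "norm w \<le> 1" and "Re w > 0" and "Im w \<ge> 0"
    and "norm (1 - w\<^sup>2) \<le> 2 * norm w"
  shows "(\<lambda>n::nat. (-1) ^ n / (of_nat (2*n+1) ^ 3 * of_nat ((2*n) choose n))
                    * ((1 - w\<^sup>2) / w) ^ (2*n+1))
    sums
     (- 2 * (polylog 3 ((1 + w) / 2) - polylog 3 ((1 - w) / 2)
             - polylog 3 ((1 + 1/w) / 2) + polylog 3 ((1 - 1/w) / 2))
      + (polylog 2 ((1 + w) / 2) - polylog 2 ((1 - w) / 2)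
         + polylog 2 ((1 + 1/w) / 2) - polylog 2 ((1 - 1/w) / 2)) * Ln w
      + of_real pi * \<i> * Ln ((1 + w) / 2) * Ln ((1 + 1/w) / 2))"
proof -
  define y where "y = (1 / w - w) / 2"
  have w: "w \<in> quarter_disc"
    using assms by (simp add: quarter_disc_def)
  have y: "y \<in> closed_lower_quarter" and joukowski_inv: "joukowski_inv y = w"
    using half_difference_in_closed_lower_quarter[OF w assms(4)] joukowski_inv_half_difference[OF w] by (simp_all add: y_def)
  have "2 * y = (1 - w\<^sup>2) / w"
    using quarter_disc_inverse(1)[OF w] by (simp add: y_def field_simps power2_eq_square)
  then have "(\<lambda>n::nat. (-1) ^ n / (of_nat (2*n+1) ^ 3 * of_nat ((2*n) choose n))
      * ((1 - w\<^sup>2) / w) ^ (2*n+1)) sums trilog_comb w"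
    using cb_series_sums[of y] cb_series_3_closed[OF y] y joukowski_inv by (simp add: closed_lower_quarter_def)
  then show ?thesis
    unfolding trilog_comb_def Ln_half_one_plus_inverse[OF w] .
qed

end
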